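(* Let $n\ge1$ and let $a_1,\dots,a_n\in\mathbb C$ be such that the $2n+2$ numbers $a_1,\dots,a_n,1-a_1,\dots,1-a_n,0,1$ are pairwise distinct; put $S=\{a_1,\dots,a_n,1-a_1,\dots,1-a_n,0,1\}$. Then for all $\alpha,\beta\in S$, $m\ge0$ and positive integers $b_1,\dots,b_m$, \begin{align*} \partial_{\alpha,\beta}(x_{b_1}\cdots x_{b_m}\triangleright e_{a_1}\cdots e_{a_n})&=x_{b_1}\cdots x_{b_m}\triangleright\partial_{\alpha,\beta}(e_{a_1}\cdots e_{a_n})\\ &\quad+(\Delta^{\alpha,\beta}_{a_1,0}+\Delta^{\alpha,\beta}_{a_1,1}-\Delta^{\alpha,\beta}_{a_1,a_1})\,\delta_{b_1,1}\,x_{b_2}\cdots x_{b_m}\triangleright e_{a_1}\cdots e_{a_n}\\ &\quad-(\Delta^{\alpha,\beta}_{a_n,0}+\Delta^{\alpha,\beta}_{a_n,1}-\Delta^{\alpha,\beta}_{a_n,a_n})\,\delta_{b_m,1}\,x_{b_1}\cdots x_{b_{m-1}}\triangleright e_{a_1}\cdots e_{a_n} \end{align*} (where for $m=0$ the last two terms are absent).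
   Context: $\mathfrak X=\mathbb Q\langle x_1,x_2,\dots\rangle$. $\mathcal A=\mathbb Q\langle e_z\mid z\in\mathbb C\rangle$, $\mathcal A^+$ its span of non-empty words, $\mathcal A(S)\subset\mathcal A$ the subalgebra generated by $e_z$, $z\in S$. $\bm\iota$ is the automorphism $e_z\mapsto e_{1-z}$; $U(b)$ ($b\ge0$) is the sum of the two alternating words of length $b$ in $e_0,e_1$ ($U(0)=2$). The bilinear map $\triangleright:\mathfrak X\times\mathcal A^+\to\mathcal A^+$: \[ x_{b_1}\cdots x_{b_m}\triangleright e_{a_1}\cdots e_{a_n}=\sum_{d=n}^{n+m}(-1)^{n+m-d}\sum_{(i_1,\dots,i_d,f)\in\mathscr B_d}e_{a_{i_1}}V_1\bm\iota^{s_1}(e_{a_{i_2}})\cdots V_{d-1}\bm\iota^{s_{d-1}}(e_{a_{i_d}}), \] where $\mathscr B_d$ is the set of ($1=i_1\le\cdots\le i_d=n$, weakly increasing $f:\{1,\dots,m\}\to\{1,\dots,d-1\}$) with $i_{k+1}-i_k\le1$ for all $k$ and $i_{k+1}-i_k=1$ whenever $f^{-1}(k)=\emptyset$; $s_k=\sum_{f(j)\le k}(b_j-1)$; $V_k=1$ if $f^{-1}(k)=\emptyset$, else $V_k=U(i_{k+1}-i_k-1+\sum_{f(j)=k}b_j)$. (For $m=0$, $1\triangleright w=w$.) For $x,y,\alpha,\beta\in\mathbb C$: $\Delta^{\alpha,\beta}_{x,y}=1$ if $\{\alpha,\beta\}\in\{\{x,y\},\{1-x,1-y\}\}$ (as sets)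 and $0$ otherwise. For $\alpha,\beta\in S$, $\partial_{\alpha,\beta}:\mathcal A(S)\to\mathcal A(S)$ is the $\mathbb Q$-linear map with $\partial_{\alpha,\beta}(1)=\partial_{\alpha,\beta}(e_z)=0$ and, for $k\ge0$, \[ \partial_{\alpha,\beta}(e_{z_0}e_{z_1}\cdots e_{z_{k+1}})=\sum_{i=1}^k\big(\Delta^{\alpha,\beta}_{z_i,z_{i+1}}-\Delta^{\alpha,\beta}_{z_i,z_{i-1}}\big)e_{z_0}\cdots\widehat{e_{z_i}}\cdots e_{z_{k+1}} \] (hat = omission). $\delta$ is the Kronecker delta.
   Formalization: The terms −Δ_{a_1,a_1} and −Δ_{a_n,a_n} are replaced by −2Δ_{a_1,a_1} and −2Δ_{a_n,a_n}; the printed formula fails for n=1, (b_1,b_2)=(1,2), α=β=a_1 (the left side is −2 x_2▷e_{a_1}, the right −x_2▷e_{a_1}), and the two agree whenever α≠β. *)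

theory Defs
  imports Complex_Main "HOL-Library.Poly_Mapping" "HOL-Library.FuncSet"
begin

text \<open>Lists are made the free monoid (concatenation written additively), so that
  \<open>'a list \<Rightarrow>\<^sub>0 rat\<close>, with the convolution product of
  \<^theory>\<open>HOL-Library.Poly_Mapping\<close>, is the free associative algebra over the rationals
  on the generators \<open>'a\<close>.\<close>

instantiation list :: (type) monoid_add
begin

definition zero_list :: "'a list" where "zero_list = []"

definition plus_list :: "'a list \<Rightarrow> 'a list \<Rightarrow> 'a list" where "plus_list = (@)"

instance by standard (simp_all add: zero_list_def plus_list_def)

end

type_synonym 'a falg = "'a list \<Rightarrow>\<^sub>0 rat"

definition word :: "'a list \<Rightarrow> 'a falg" where
  "word w = Poly_Mapping.single w 1"

lemma word_Nil: "word [] = 1"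
  by (simp add: word_def flip: zero_list_def)

lemma word_append: "word (u @ v) = word u * word v"
  by (simp add: word_def mult_single plus_list_def)

lemma word_eq_prod_list: "word w = prod_list (map (\<lambda>z. word [z]) w)"
proof (induction w)
  case (Cons z w)
  then show ?case using word_append[of "[z]" w] by simp
qed (simp add: word_Nil)

definition scal :: "rat \<Rightarrow> 'a falg \<Rightarrow> 'a falg" where
  "scal c p = Poly_Mapping.map ((*) c) p"

text \<open>The rational-linear extension of a map given on words.\<close>

definition lin_ext :: "('a list \<Rightarrow> 'b falg) \<Rightarrow> 'a falg \<Rightarrow> 'b falg" where
  "lin_ext g p = (\<Sum>w\<in>Poly_Mapping.keys p. scal (Poly_Mapping.lookup p w) (g w))"

text \<open>\<open>complex falg\<close> is the algebra on the letters \<open>e\<^sub>z\<close>, i.e. \<open>e\<^sub>z = word [z]\<close>.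
  In \<open>nat falg\<close> the letter \<open>b\<close> stands for \<open>x\<^sub>b\<close>; the algebra on \<open>x\<^sub>1, x\<^sub>2, \<dots>\<close> is
  its subalgebra spanned by the words in positive letters, and \<open>x\<^sub>0\<close> is never used.\<close>

definition iota :: "complex falg \<Rightarrow> complex falg" where
  "iota = lin_ext (\<lambda>w. word (map (\<lambda>z. 1 - z) w))"

primrec alt_word :: "complex \<Rightarrow> nat \<Rightarrow> complex list" where
  "alt_word z 0 = []"
| "alt_word z (Suc b) = z # alt_word (1 - z) b"

definition U :: "nat \<Rightarrow> complex falg" where
  "U b = word (alt_word 0 b) + word (alt_word 1 b)"

text \<open>The index set of the sum at \<open>d\<close>; the functions are extensional, so that the set is finite
  and each pair of sequences occurs once.\<close>

definition index_pairs :: "nat \<Rightarrow> nat \<Rightarrow> nat \<Rightarrow> ((nat \<Rightarrow> nat) \<times> (nat \<Rightarrow> nat)) set" where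
  "index_pairs n m d =
     {(i, f). i \<in> {1..d} \<rightarrow>\<^sub>E {1..n} \<and> i 1 = 1 \<and> i d = n \<and> mono_on {1..d} i \<and>
              f \<in> {1..m} \<rightarrow>\<^sub>E {1..d - 1} \<and> mono_on {1..m} f \<and>
              (\<forall>k\<in>{1..<d}. i (k + 1) - i k \<le> 1 \<and>
                 ({j\<in>{1..m}. f j = k} = {} \<longrightarrow> i (k + 1) - i k = 1))}"

text \<open>Lists are indexed from 0, sequences in the formulas from 1, whence \<open>b ! (j - 1)\<close>.
  In \<open>tri_V\<close> the subtraction of 1 is done last: \<open>i (k + 1) - i k\<close> may be 0, but the sum over
  \<open>f j = k\<close> is positive.\<close>

definition tri_s :: "nat list \<Rightarrow> (nat \<Rightarrow> nat) \<Rightarrow> nat \<Rightarrow> nat" where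
  "tri_s b f k = (\<Sum>j | j \<in> {1..length b} \<and> f j \<le> k. b ! (j - 1) - 1)"

definition tri_V :: "nat list \<Rightarrow> (nat \<Rightarrow> nat) \<Rightarrow> (nat \<Rightarrow> nat) \<Rightarrow> nat \<Rightarrow> complex falg" where
  "tri_V b i f k =
     (if {j\<in>{1..length b}. f j = k} = {} then 1
      else U (i (k + 1) - i k + (\<Sum>j | j \<in> {1..length b} \<and> f j = k. b ! (j - 1)) - 1))"

definition tri_term ::
  "nat list \<Rightarrow> complex list \<Rightarrow> nat \<Rightarrow> (nat \<Rightarrow> nat) \<Rightarrow> (nat \<Rightarrow> nat) \<Rightarrow> complex falg" where
  "tri_term b a d i f =
     word [a ! (i 1 - 1)] *
     prod_list (map (\<lambda>k. tri_V b i f k * (iota ^^ tri_s b f k) (word [a ! (i (k + 1) - 1)])) [1..<d])"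

text \<open>The operation is only meant for a right argument in the span of the non-empty words;
  it is extended by 0 on the empty word.\<close>

definition tri_word :: "nat list \<Rightarrow> complex list \<Rightarrow> complex falg" where
  "tri_word b a =
     (if a = [] then 0
      else \<Sum>d = length a..length a + length b.
             (- 1) ^ (length a + length b - d) *
             (\<Sum>(i, f)\<in>index_pairs (length a) (length b) d. tri_term b a d i f))"

definition tri :: "nat falg \<Rightarrow> complex falg \<Rightarrow> complex falg" (infixr \<open>\<triangleright>\<close> 75) where
  "P \<triangleright> w = lin_ext (\<lambda>b. lin_ext (\<lambda>a. tri_word b a) w) P"

definition Delta :: "complex \<Rightarrow> complex \<Rightarrow> complex \<Rightarrow> complex \<Rightarrow> rat" where
  "Delta \<alpha> \<beta> x y = of_bool ({\<alpha>, \<beta>} \<in> {{x, y}, {1 - x, 1 - y}})"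

text \<open>On the diagonal, \<open>Delta \<alpha> \<alpha> x y = 1\<close> iff \<open>x = y \<and> (x = \<alpha> \<or> x = 1 - \<alpha>)\<close>. The theorem
  has the boundary coefficient \<open>Delta z 0 + Delta z 1 - 2 * Delta z z\<close>, not
  \<open>\<dots> - Delta z z\<close> as in the source: the two agree for \<open>\<alpha> \<noteq> \<beta>\<close> (then \<open>Delta z z = 0\<close>), and for
  \<open>\<alpha> = \<beta>\<close> the factor 2, which comes from \<open>U 0 = 2\<close>, is needed: for \<open>\<alpha> = \<beta> = z\<close> and the word
  \<open>x\<^sub>1 x\<^sub>2 \<triangleright> e\<^sub>z\<close> the derivation yields \<open>-2 (x\<^sub>2 \<triangleright> e\<^sub>z)\<close>.\<close>

text \<open>For \<open>\<alpha>, \<beta> \<in> S\<close> the map below restricts to an endomorphism of the subalgebra generated by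
  the \<open>e\<^sub>z\<close> with \<open>z \<in> S\<close>, and does not depend on \<open>S\<close>. On words of length at most 2 the sum is
  empty.\<close>

definition pd_word :: "complex \<Rightarrow> complex \<Rightarrow> complex list \<Rightarrow> complex falg" where
  "pd_word \<alpha> \<beta> z =
     (\<Sum>i = 1..length z - 2.
        scal (Delta \<alpha> \<beta> (z ! i) (z ! (i + 1)) - Delta \<alpha> \<beta> (z ! i) (z ! (i - 1)))
             (word (take i z @ drop (i + 1) z)))"

definition pd :: "complex \<Rightarrow> complex \<Rightarrow> complex falg \<Rightarrow> complex falg" where
  "pd \<alpha> \<beta> = lin_ext (pd_word \<alpha> \<beta>)"

end

(* The word x_b |> e_a satisfies a recursion obtained by splitting off the first step of an index pair:
   the first letter of a is followed by the block sums blk U, in which U(k) has absorbed the first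
   block of b. The operator left_del z deletes letters to the right of z, so that applying the
   derivation to z w means applying left_del z to w. On U(k) R it telescopes up to boundary terms
   involving U(k) and the difference A(k) = alt_diff k of the two alternating words; the latter are controlled
   by U(k) A(j) + (-1)^k A(k) U(j) = 2 (-1)^k A(k + j). This closes an induction on b and a for the
   theorem together with formulas for left_del z of the block sums. *)
theory Submission
  imports Defs
begin

subsection \<open>Linear maps on the free algebra\<close>

text \<open>The weight of a deletion depends on the neighbouring letters. A block U(k) with k \<ge>
  1 begins and ends with 0 or 1, whereas U(0) = 2 has no letter. Writing \<open>D z 0\<close> and
  \<open>D z 1\<close> as mean plus or minus half difference separates two effects: the mean weighs
  both alternating words equally and reproduces U, the half difference gives them opposite signs and
  so turns U into A. Reflecting z fixes the mean and negates the half difference, which matches the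
  signs caused by \<open>iota\<close>. If b_1 = 1, the first block can be U(0), and then z stands
  next to another z. The two copies in U(0) = 2 contribute 2 \<open>D z z\<close> where a block with
  letters would contribute \<open>D z 0 + D z 1\<close>; the discrepancy is the boundary coefficient
  \<open>bdry z\<close>. The theorem alone is not inductive: splitting off the first letter leaves
  block sums, and deletion in them depends on a left neighbour that need not be related to the
  letter after the block. Hence the auxiliary formulas have two independent letters and carry terms
  with A, which cancel only when the three summands of the recursion are put together.\<close>

lemma lookup_scal [simp]: "Poly_Mapping.lookup (scal c p) w = c * Poly_Mapping.lookup p w"
  by (simp add: scal_def Poly_Mapping.map.rep_eq when_def)

interpretation falg: vector_space "scal :: rat \<Rightarrow> 'a falg \<Rightarrow> 'a falg"
  by standard (auto intro!: poly_mapping_eqI simp: lookup_add algebra_simps)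

lemma scal_single: "scal c (Poly_Mapping.single w r) = Poly_Mapping.single w (c * r)"
  by (auto intro!: poly_mapping_eqI simp: lookup_single when_def)

text \<open>Lets an identity that is linear in \<open>p\<close> be checked on scaled words
  alone.\<close>

lemma falg_induct [case_names word add]:
  assumes word: "\<And>c w. P (scal c (word w))"
    and add: "\<And>p q. P p \<Longrightarrow> P q \<Longrightarrow> P (p + q)"
  shows "P p"
proof (induction p rule: update_induct)
  case const
  then show ?case using word[of 0] by simp
next
  case (update p w r)
  have "Poly_Mapping.update w r p = p + scal r (word w)"
    using update(1)
    by (auto intro!: poly_mapping_eqI
        simp: lookup_update lookup_add word_def lookup_single when_def in_keys_iff)
  then show ?case using update add word by metis
qed

lemma lin_ext_eq_sum:
  assumes "finite A" "Poly_Mapping.keys p \<subseteq> A"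
  shows "lin_ext g p = (\<Sum>w\<in>A. scal (Poly_Mapping.lookup p w) (g w))"
  unfolding lin_ext_def using assms
  by (intro sum.mono_neutral_left) (auto simp: in_keys_iff)

lemma hom_lin_ext: "module_hom scal scal (lin_ext g)"
proof (intro module_hom.intro module_hom_axioms.intro falg.module_axioms)
  fix p q :: "'a falg" and c :: rat
  let ?A = "Poly_Mapping.keys p \<union> Poly_Mapping.keys q"
  have "lin_ext g (p + q) = (\<Sum>w\<in>?A. scal (Poly_Mapping.lookup (p + q) w) (g w))"
    using keys_add[of p q] by (intro lin_ext_eq_sum) auto
  also have "\<dots> = lin_ext g p + lin_ext g q"
    by (simp add: lin_ext_eq_sum[of ?A] lookup_add falg.scale_left_distrib sum.distrib)
  finally show "lin_ext g (p + q) = lin_ext g p + lin_ext g q" .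
  have "lin_ext g (scal c p)
      = (\<Sum>w\<in>Poly_Mapping.keys p. scal (Poly_Mapping.lookup (scal c p) w) (g w))"
    by (intro lin_ext_eq_sum) (auto simp: in_keys_iff)
  then show "lin_ext g (scal c p) = scal c (lin_ext g p)"
    by (simp add: lin_ext_def falg.scale_sum_right)
qed

lemma lin_ext_word [simp]: "lin_ext g (word w) = g w"
  by (simp add: lin_ext_def word_def)

lemmas lin_ext_simps [simp] =
  module_hom.add[OF hom_lin_ext] module_hom.diff[OF hom_lin_ext] module_hom.neg[OF hom_lin_ext]
  module_hom.zero[OF hom_lin_ext] module_hom.scale[OF hom_lin_ext]
  module_hom.sum[OF hom_lin_ext]

lemma scal_mult_left: "scal c p * q = scal c (p * q)"
proof -
  \<comment> \<open>Scaling is multiplication by a constant monomial, so associativity gives the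
    claim.\<close>
  have *: "scal c p = Poly_Mapping.single [] c * p" for p :: "'a falg"
    by (induction p rule: falg_induct)
       (simp_all add: word_def mult_single plus_list_def scal_single falg.scale_right_distrib
         distrib_left)
  show ?thesis by (simp only: * mult.assoc)
qed

lemma scal_mult_right: "p * scal c q = scal c (p * q)"
proof (induction q rule: falg_induct)
  case (word d w)
  show ?case
    by (induction p rule: falg_induct)
       (simp_all add: word_def scal_single mult_single falg.scale_right_distrib distrib_right
         mult.left_commute)
qed (simp add: falg.scale_right_distrib distrib_left)

lemmas falg_simps =
  scal_mult_left scal_mult_right falg.scale_right_distrib falg.scale_right_diff_distrib
  falg.scale_left_distrib falg.scale_left_diff_distrib distrib_left distrib_right
  left_diff_distrib right_diff_distrib

lemma word_Cons: "word (z # w) = word [z] * word w"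
  using word_append[of "[z]" w] by simp

subsection \<open>The reflection of letters\<close>

text \<open>This is \<open>iota ^^ k\<close> on a letter; in the parity form exponents simply add
  under composition.\<close>

definition refl_letter :: "nat \<Rightarrow> complex \<Rightarrow> complex" where
  "refl_letter k z = (if even k then z else 1 - z)"

lemma refl_letter_add: "refl_letter j (refl_letter k z) = refl_letter (j + k) z"
  by (auto simp: refl_letter_def)

lemma refl_letter_0 [simp]: "refl_letter 0 = id"
  by (auto simp: refl_letter_def)

lemma hom_mult_left: "module_hom scal scal (\<lambda>p. q * p)"
  by (intro module_hom.intro module_hom_axioms.intro falg.module_axioms) (simp_all add: falg_simps)

lemma iota_word: "iota (word w) = word (map ((-) 1) w)"
  by (simp add: iota_def)

lemma iota_pow_word: "(iota ^^ s) (word w) = word (map (refl_letter s) w)"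
proof (induction s)
  case (Suc s)
  have "(-) 1 \<circ> refl_letter s = refl_letter (Suc s)"
    by (auto simp: refl_letter_def)
  then show ?case using Suc by (simp add: iota_word)
qed simp

lemma prod_list_cong_upt:
  "(\<And>k. m \<le> k \<Longrightarrow> k < n \<Longrightarrow> g k = h k) \<Longrightarrow> prod_list (map g [m..<n]) = prod_list (map h [m..<n])"
  by (intro arg_cong[of _ _ prod_list] map_cong) auto

subsection \<open>Splitting off the first step of an index pair\<close>

text \<open>The first \<open>r\<close> letters of \<open>b\<close> will form the first block; the
  shift renumbers the others as positions of \<open>drop r b\<close>.\<close>

lemma sum_split_shift:
  fixes g :: "nat \<Rightarrow> 'a :: comm_monoid_add"
  assumes "r \<le> m"
  shows "(\<Sum>j | j \<in> {1..m} \<and> P j. g j) =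
         (\<Sum>j | j \<in> {1..r} \<and> P j. g j) + (\<Sum>j | j \<in> {1..m - r} \<and> P (j + r). g (j + r))"
proof -
  have "{j. j \<in> {1..m} \<and> P j} =
      {j. j \<in> {1..r} \<and> P j} \<union> (\<lambda>j. j + r) ` {j. j \<in> {1..m - r} \<and> P (j + r)}" (is "_ = ?A \<union> ?B")
  proof (intro set_eqI iffI)
    fix j assume *: "j \<in> {j. j \<in> {1..m} \<and> P j}"
    show "j \<in> ?A \<union> ?B"
    proof (cases "j \<le> r")
      case False
      with * have "j = (j - r) + r" "j - r \<in> {j. j \<in> {1..m - r} \<and> P (j + r)}" by auto
      then show ?thesis by blast
    qed (use * in auto)
  qed (use assms in auto)
  then have "sum g {j. j \<in> {1..m} \<and> P j} = sum g (?A \<union> ?B)" by (rule arg_cong)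
  also have "\<dots> = sum g ?A + sum g ?B"
    by (intro sum.union_disjoint) auto
  also have "sum g ?B = (\<Sum>j | j \<in> {1..m - r} \<and> P (j + r). g (j + r))"
    by (subst sum.reindex) (auto simp: inj_on_def)
  finally show ?thesis .
qed

lemma sum_list_take_eq_sum:
  assumes "r \<le> length b"
  shows "(\<Sum>x\<leftarrow>take r b. g x) = (\<Sum>j = 1..r. g (b ! (j - 1)) :: nat)"
  using assms
proof (induction r)
  case (Suc r)
  then show ?case by (simp add: take_Suc_conv_app_nth)
qed simp

text \<open>Every exponent \<open>tri_s b f k\<close> with k \<ge> 1 contains the contribution of
  the first \<open>r\<close> letters, so this common reflection can be moved into the letters of the
  remaining word. For \<epsilon> = 0 the current letter of \<open>a\<close> is kept and reappears,
  reflected, at the head of the remaining term.\<close>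

lemma tri_term_split_first:
  assumes r: "r \<le> length b" and d: "d \<ge> 1" and a: "a \<noteq> []"
    and i1: "i 1 = 1" and i: "\<And>k. k \<in> {1..d} \<Longrightarrow> i (k + 1) = i' k + \<epsilon>"
    and i': "\<And>k. k \<in> {1..d} \<Longrightarrow> i' k \<in> {1..length a - \<epsilon>}" and i'1: "i' 1 = 1"
    and f1: "\<And>j. j \<in> {1..r} \<Longrightarrow> f j = 1"
    and f: "\<And>j. j \<in> {1..length b - r} \<Longrightarrow> f (j + r) = f' j + 1"
    and f': "\<And>j. j \<in> {1..length b - r} \<Longrightarrow> f' j \<ge> 1"
  shows "tri_term b a (Suc d) i f =
     word [hd a] * (if r = 0 then 1 else U (\<epsilon> + sum_list (take r b) - 1)) *
     tri_term (drop r b) (map (refl_letter (\<Sum>x\<leftarrow>take r b. x - 1)) (drop \<epsilon> a)) d i' f'"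
proof -
  define s where "s = (\<Sum>x\<leftarrow>take r b. x - 1)"
  have nth: "drop r b ! (j - 1) = b ! (j + r - 1)" if "j \<in> {1..length b - r}" for j
    using that r by (auto simp: add.commute)
  have f1_sets: "{j. j \<in> {1..r} \<and> f j = 1} = {1..r}"
    "{j. j \<in> {1..length b - r} \<and> f (j + r) = 1} = {}"
    using f1 f f' by force+
  have fk_sets: "{j. j \<in> {1..r} \<and> f j = k + 1} = {}"
    "{j. j \<in> {1..r} \<and> f j \<le> k + 1} = {1..r}" if "k \<ge> 1" for k
    using f1 that by auto
  have fk_sets': "{j. j \<in> {1..length b - r} \<and> f (j + r) = k + 1} = {j. j \<in> {1..length b - r} \<and> f' j = k}"
    "{j. j \<in> {1..length b - r} \<and> f (j + r) \<le> k + 1} = {j. j \<in> {1..length b - r} \<and> f' j \<le> k}" for k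
    using f by auto
  have f1_le: "{j. j \<in> {1..r} \<and> f j \<le> 1} = {1..r}"
    "{j. j \<in> {1..length b - r} \<and> f (j + r) \<le> 1} = {}"
    using f1 f f' by force+
  have empty1: "{j \<in> {1..length b}. f j = 1} = {} \<longleftrightarrow> r = 0"
  proof
    assume "{j \<in> {1..length b}. f j = 1} = {}"
    then show "r = 0" using f1[of 1] r by (cases "r = 0") auto
  next
    assume "r = 0"
    then show "{j \<in> {1..length b}. f j = 1} = {}" using f f' by force
  qed
  have emptyk: "{j \<in> {1..length b}. f j = k + 1} = {} \<longleftrightarrow> {j \<in> {1..length b - r}. f' j = k} = {}"
    if "k \<ge> 1" for k
  proof -
    have "{j \<in> {1..length b}. f j = k + 1} = (\<lambda>j. j + r) ` {j \<in> {1..length b - r}. f' j = k}"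
    proof (intro set_eqI iffI)
      fix j assume *: "j \<in> {j \<in> {1..length b}. f j = k + 1}"
      then have "j > r" using f1[of j] that by (cases "j \<le> r") auto
      then have "j = (j - r) + r" "j - r \<in> {1..length b - r}"
        using * by auto
      moreover from this have "f' (j - r) = k" using * f[of "j - r"] by auto
      ultimately have "j = (j - r) + r" "j - r \<in> {j \<in> {1..length b - r}. f' j = k}" by auto
      then show "j \<in> (\<lambda>j. j + r) ` {j \<in> {1..length b - r}. f' j = k}" by blast
    qed (use f in auto)
    then show ?thesis by simp
  qed
  have V1: "tri_V b i f 1 = (if r = 0 then 1 else U (\<epsilon> + sum_list (take r b) - 1))"
  proof -
    have "i (1 + 1) - i 1 = \<epsilon>" using i[of 1] i'1 i1 d by simp
    moreover have "(\<Sum>j | j \<in> {1..length b} \<and> f j = 1. b ! (j - 1)) = sum_list (take r b)"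
      using sum_list_take_eq_sum[OF r, of "\<lambda>x. x"] unfolding sum_split_shift[OF r] f1_sets by simp
    ultimately show ?thesis unfolding tri_V_def empty1 by simp
  qed
  have s1: "tri_s b f 1 = s"
    unfolding tri_s_def s_def sum_list_take_eq_sum[OF r] sum_split_shift[OF r] f1_le by simp
  have V: "tri_V b i f (k + 1) = tri_V (drop r b) i' f' k" if k: "k \<in> {1..<d}" for k
  proof -
    have *: "i (k + 1 + 1) - i (k + 1) = i' (k + 1) - i' k" using i[of k] i[of "k + 1"] k by auto
    have "(\<Sum>j | j \<in> {1..length b} \<and> f j = k + 1. b ! (j - 1)) =
        (\<Sum>j | j \<in> {1..length b - r} \<and> f' j = k. drop r b ! (j - 1))"
      using k nth unfolding sum_split_shift[OF r] fk_sets' by (subst fk_sets) (auto intro!: sum.cong)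
    then show ?thesis
      using emptyk[of k] k unfolding tri_V_def * length_drop by auto
  qed
  have s: "tri_s b f (k + 1) = s + tri_s (drop r b) f' k" if k: "k \<in> {1..<d}" for k
  proof -
    have "(\<Sum>j | j \<in> {1..length b - r} \<and> f (j + r) \<le> k + 1. b ! (j + r - 1) - 1) = tri_s (drop r b) f' k"
      unfolding tri_s_def length_drop fk_sets' using nth by (intro sum.cong) auto
    moreover have "(\<Sum>j | j \<in> {1..r} \<and> f j \<le> k + 1. b ! (j - 1) - 1) = s"
      unfolding s_def sum_list_take_eq_sum[OF r] using k by (subst fk_sets) auto
    ultimately show ?thesis
      unfolding tri_s_def[of b] sum_split_shift[OF r] by simp
  qed
  have ak: "(iota ^^ t) (word [map (refl_letter s) (drop \<epsilon> a) ! (i' k - 1)]) = (iota ^^ (s + t)) (word [a ! (i (k + 1) - 1)])"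
    if "k \<in> {1..d}" for k t
  proof -
    have "map (refl_letter s) (drop \<epsilon> a) ! (i' k - 1) = refl_letter s (a ! (i (k + 1) - 1))"
      using i[OF that] i'[OF that] by (auto simp: add.commute)
    then show ?thesis by (simp add: iota_pow_word refl_letter_add add.commute)
  qed
  have "tri_term b a (Suc d) i f = word [hd a] * ((tri_V b i f 1 * (iota ^^ s) (word [a ! (i (1 + 1) - 1)])) *
      prod_list (map (\<lambda>k. tri_V b i f (k + 1) * (iota ^^ tri_s b f (k + 1)) (word [a ! (i (k + 1 + 1) - 1)])) [1..<d]))"
  proof -
    have "[1..<Suc d] = 1 # map Suc [1..<d]" using d by (simp add: upt_conv_Cons map_Suc_upt)
    then show ?thesis using a i1 s1 by (simp add: tri_term_def hd_conv_nth o_def)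
  qed
  also have "\<dots> = word [hd a] * (tri_V b i f 1 *
      (word [map (refl_letter s) (drop \<epsilon> a) ! (i' 1 - 1)] * prod_list (map (\<lambda>k. tri_V (drop r b) i' f' k *
        (iota ^^ tri_s (drop r b) f' k) (word [map (refl_letter s) (drop \<epsilon> a) ! (i' (k + 1) - 1)])) [1..<d])))"
    using ak[of 1 0] d ak unfolding mult.assoc
    by (intro arg_cong2[of _ _ _ _ "(*)"] refl prod_list_cong_upt) (auto simp: V[simplified] s[simplified])
  finally show ?thesis
    by (simp add: V1[simplified] s_def tri_term_def mult.assoc)
qed

lemma index_pairs_D:
  assumes "(i, f) \<in> index_pairs n m d"
  shows "i \<in> {1..d} \<rightarrow>\<^sub>E {1..n}" "i 1 = 1" "i d = n" "mono_on {1..d} i"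
    "f \<in> {1..m} \<rightarrow>\<^sub>E {1..d - 1}" "mono_on {1..m} f"
    "k \<in> {1..<d} \<Longrightarrow> i (k + 1) - i k \<le> 1"
    "k \<in> {1..<d} \<Longrightarrow> {j \<in> {1..m}. f j = k} = {} \<Longrightarrow> i (k + 1) - i k = 1"
  using assms by (auto simp: index_pairs_def)

lemma finite_index_pairs: "finite (index_pairs n m d)"
  by (rule finite_subset[of _ "({1..d} \<rightarrow>\<^sub>E {1..n}) \<times> ({1..m} \<rightarrow>\<^sub>E {1..d - 1})"])
     (auto simp: index_pairs_def intro!: finite_PiE)

text \<open>Since \<open>i 1 = 1\<close>, the first entry is the rise of \<open>i\<close> in the
  first step.\<close>

definition first_step :: "nat \<Rightarrow> (nat \<Rightarrow> nat) \<times> (nat \<Rightarrow> nat) \<Rightarrow> nat \<times> nat" where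
  "first_step m = (\<lambda>(i, f). (i 2 - 1, card {j \<in> {1..m}. f j = 1}))"

definition tail_pair :: "nat \<Rightarrow> nat \<Rightarrow> nat \<Rightarrow> nat \<Rightarrow>
    (nat \<Rightarrow> nat) \<times> (nat \<Rightarrow> nat) \<Rightarrow> (nat \<Rightarrow> nat) \<times> (nat \<Rightarrow> nat)" where
  "tail_pair m d \<epsilon> r =
     (\<lambda>(i, f). (restrict (\<lambda>k. i (k + 1) - \<epsilon>) {1..d}, restrict (\<lambda>j. f (j + r) - 1) {1..m - r}))"

definition cons_pair :: "nat \<Rightarrow> nat \<Rightarrow> nat \<Rightarrow> nat \<Rightarrow>
    (nat \<Rightarrow> nat) \<times> (nat \<Rightarrow> nat) \<Rightarrow> (nat \<Rightarrow> nat) \<times> (nat \<Rightarrow> nat)" where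
  "cons_pair m d \<epsilon> r =
     (\<lambda>(i, f). (restrict (\<lambda>k. if k = 1 then 1 else i (k - 1) + \<epsilon>) {1..Suc d},
                restrict (\<lambda>j. if j \<le> r then 1 else f (j - r) + 1) {1..m}))"

text \<open>By monotonicity, and since 1 is the least possible value, every position before one with
  value 1 also has value 1. The fibre is thus an initial segment, known from its
  cardinality.\<close>

lemma mono_first_fibre:
  assumes "mono_on {1..m} f" "f \<in> {1..m} \<rightarrow> {1..(d::nat)}" "card {j \<in> {1..m}. f j = 1} = r"
  shows "{j \<in> {1..m}. f j = 1} = {1..(r::nat)}" and "r \<le> m"
proof -
  let ?A = "{j \<in> {1..m}. f j = 1}"
  have "j \<in> ?A" if "j \<ge> 1" "j \<le> k" "k \<in> ?A" for j k
    using mono_onD[OF assms(1), of j k] that assms(2) by (force simp: Pi_iff)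
  then have *: "{1..k} \<subseteq> ?A" if "k \<in> ?A" for k
    using that by auto
  have "?A = {1..r}"
  proof (cases "?A = {}")
    case True
    then show ?thesis using assms(3)[unfolded True] by simp
  next
    case False
    have "?A \<subseteq> {1..Max ?A}" by (auto intro!: Max_ge)
    moreover have "{1..Max ?A} \<subseteq> ?A" by (intro * Max_in) (use False in auto)
    ultimately have "?A = {1..Max ?A}" by blast
    then show ?thesis using assms(3) by (metis card_atLeastAtMost diff_Suc_1)
  qed
  then show "?A = {1..r}" .
  have "card ?A \<le> card {1..m}" by (intro card_mono) auto
  then show "r \<le> m" using assms(3) by simp
qed

lemma first_stepD:
  assumes "(i, f) \<in> index_pairs n m (Suc d)" "first_step m (i, f) = (\<epsilon>, r)" "d \<ge> 1"
  shows "i 2 = 1 + \<epsilon>" "\<epsilon> \<le> 1" "r \<le> m" "(\<epsilon>, r) \<noteq> (0, 0)"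
    "\<And>k. k \<in> {1..d} \<Longrightarrow> i (k + 1) \<ge> 1 + \<epsilon> \<and> i (k + 1) \<le> n"
    "\<And>j. j \<in> {1..r} \<Longrightarrow> f j = 1"
    "\<And>j. j \<in> {1..m - r} \<Longrightarrow> f (j + r) \<ge> 2 \<and> f (j + r) \<le> d"
proof -
  note D = index_pairs_D[OF assms(1)]
  have Pi: "f \<in> {1..m} \<rightarrow> {1..d}" using D(5) by auto
  have "card {j \<in> {1..m}. f j = 1} = r" using assms(2) by (simp add: first_step_def)
  note F = mono_first_fibre[OF D(6) Pi this]
  have "i 2 \<ge> 1" using D(1) assms(3) by (auto simp: PiE_iff)
  then show i2: "i 2 = 1 + \<epsilon>" using assms(2) by (auto simp: first_step_def)
  show eps: "\<epsilon> \<le> 1" using D(7)[of 1] D(2) i2 assms(3) by (simp add: numeral_2_eq_2)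
  show "r \<le> m" by (fact F(2))
  \<comment> \<open>An empty fibre over 1 forces \<open>i\<close> to rise, so a step without rise
    and without letters of \<open>b\<close> cannot occur.\<close>
  show "(\<epsilon>, r) \<noteq> (0, 0)"
  proof
    assume *: "(\<epsilon>, r) = (0, 0)"
    then have "{j \<in> {1..m}. f j = 1} = {}" using F(1) by simp
    then show False using D(8)[of 1] D(2) i2 assms(3) * by (simp add: numeral_2_eq_2)
  qed
  show "i (k + 1) \<ge> 1 + \<epsilon> \<and> i (k + 1) \<le> n" if "k \<in> {1..d}" for k
    using mono_onD[OF D(4), of 2 "k + 1"] i2 D(1) that by (auto simp: PiE_iff)
  show "f j = 1" if "j \<in> {1..r}" for j
    using F(1) that by blast
  show "f (j + r) \<ge> 2 \<and> f (j + r) \<le> d" if "j \<in> {1..m - r}" for j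
  proof -
    have "j + r \<in> {1..m}" "j + r \<notin> {1..r}" using that by auto
    then have "f (j + r) \<noteq> 1" "f (j + r) \<in> {1..d}" using F(1) Pi by blast+
    then show ?thesis by auto
  qed
qed

lemma tail_pair_in:
  assumes "(i, f) \<in> index_pairs n m (Suc d)" "first_step m (i, f) = (\<epsilon>, r)" "d \<ge> 1"
  shows "tail_pair m d \<epsilon> r (i, f) \<in> index_pairs (n - \<epsilon>) (m - r) d"
proof -
  note D = index_pairs_D[OF assms(1)]
  note F = first_stepD[OF assms]
  define i' where "i' = restrict (\<lambda>k. i (k + 1) - \<epsilon>) {1..d}"
  define f' where "f' = restrict (\<lambda>j. f (j + r) - 1) {1..m - r}"
  have "i' \<in> {1..d} \<rightarrow>\<^sub>E {1..n - \<epsilon>}"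
    using F(5) by (fastforce simp: i'_def)
  moreover have "i' 1 = 1" "i' d = n - \<epsilon>"
    using F(1) D(3) assms(3) by (auto simp: i'_def numeral_2_eq_2)
  moreover have "mono_on {1..d} i'"
    by (intro mono_onI) (auto simp: i'_def intro!: diff_le_mono mono_onD[OF D(4)])
  moreover have "f' \<in> {1..m - r} \<rightarrow>\<^sub>E {1..d - 1}"
    using F(7) by (fastforce simp: f'_def)
  moreover have "mono_on {1..m - r} f'"
    by (intro mono_onI) (auto simp: f'_def intro!: diff_le_mono mono_onD[OF D(6)])
  moreover have "i' (k + 1) - i' k \<le> 1 \<and> ({j \<in> {1..m - r}. f' j = k} = {} \<longrightarrow> i' (k + 1) - i' k = 1)"
    if k: "k \<in> {1..<d}" for k
  proof -
    have *: "i' (k + 1) - i' k = i (k + 1 + 1) - i (k + 1)"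
      using F(5)[of k] F(5)[of "k + 1"] k by (auto simp: i'_def)
    have "{j \<in> {1..m}. f j = k + 1} = {}" if e: "{j \<in> {1..m - r}. f' j = k} = {}"
    proof (rule ccontr)
      assume "{j \<in> {1..m}. f j = k + 1} \<noteq> {}"
      then obtain j where j: "j \<in> {1..m}" "f j = k + 1" by auto
      then have "j \<notin> {1..r}" using F(6)[of j] k by auto
      then have "j - r \<in> {j \<in> {1..m - r}. f' j = k}" using j by (auto simp: f'_def)
      then show False using e by blast
    qed
    then show ?thesis unfolding * using D(7,8)[of "k + 1"] k by auto
  qed
  ultimately have "(i', f') \<in> index_pairs (n - \<epsilon>) (m - r) d"
    unfolding index_pairs_def by blast
  then show ?thesis by (simp add: tail_pair_def i'_def f'_def)
qed

text \<open>Excluding (0, 0) is exactly the condition at k = 1 for an empty fibre; the conditions at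
  larger k are those of the shorter pair at k - 1.\<close>

lemma cons_pair_in:
  assumes "(i, f) \<in> index_pairs (n - \<epsilon>) (m - r) d" "\<epsilon> \<le> 1" "r \<le> m" "(\<epsilon>, r) \<noteq> (0, 0)" "d \<ge> 1"
  shows "cons_pair m d \<epsilon> r (i, f) \<in> index_pairs n m (Suc d)"
    and "first_step m (cons_pair m d \<epsilon> r (i, f)) = (\<epsilon>, r)"
proof -
  note D = index_pairs_D[OF assms(1)]
  define i' where "i' = restrict (\<lambda>k. if k = 1 then 1 else i (k - 1) + \<epsilon>) {1..Suc d}"
  define f' where "f' = restrict (\<lambda>j. if j \<le> r then 1 else f (j - r) + 1) {1..m}"
  have ipos: "i k \<ge> 1" "i k \<le> n - \<epsilon>" if "k \<in> {1..d}" for k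
    using D(1) that by (auto simp: PiE_iff)
  have fpos: "f k \<ge> 1" "f k \<le> d - 1" if "k \<in> {1..m - r}" for k
    using D(5) that by (auto simp: PiE_iff)
  have n: "n - \<epsilon> \<ge> 1" using ipos[of 1] assms(5) by auto
  have i'_in: "i' \<in> {1..Suc d} \<rightarrow>\<^sub>E {1..n}"
    unfolding i'_def restrict_PiE_iff
  proof
    fix k assume k: "k \<in> {1..Suc d}"
    then consider "k = 1" | "k - 1 \<in> {1..d}" "k \<noteq> 1" by fastforce
    then show "(if k = 1 then 1 else i (k - 1) + \<epsilon>) \<in> {1..n}"
    proof cases
      case 2
      then show ?thesis using ipos[OF 2(1)] n by auto
    qed (use n in auto)
  qed
  have "i' 1 = 1" "i' (Suc d) = n"
    using D(3) assms(5) n by (auto simp: i'_def)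
  moreover have "mono_on {1..Suc d} i'"
  proof (intro mono_onI)
    fix j k assume jk: "j \<in> {1..Suc d}" "k \<in> {1..Suc d}" "j \<le> k"
    show "i' j \<le> i' k"
    proof (cases "j = 1")
      case True
      have "i' k \<in> {1..n}" using i'_in jk(2) by (rule PiE_mem)
      then show ?thesis using True jk by (simp add: i'_def)
    next
      case False
      then show ?thesis using jk mono_onD[OF D(4), of "j - 1" "k - 1"] by (auto simp: i'_def)
    qed
  qed
  moreover have "f' \<in> {1..m} \<rightarrow>\<^sub>E {1..d}"
  proof (rule PiE_I)
    fix j assume "j \<in> {1..m}"
    then consider "j \<le> r" "j \<in> {1..m}" | "j - r \<in> {1..m - r}" "\<not> j \<le> r" "j \<in> {1..m}"
      by fastforce
    then show "f' j \<in> {1..d}"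
    proof cases
      case 2
      then show ?thesis using fpos[OF 2(1)] assms(5) by (auto simp: f'_def)
    qed (use assms(5) in \<open>auto simp: f'_def\<close>)
  qed (auto simp: f'_def)
  moreover have "mono_on {1..m} f'"
  proof (intro mono_onI)
    fix j k assume jk: "j \<in> {1..m}" "k \<in> {1..m}" "j \<le> k"
    then show "f' j \<le> f' k"
      using mono_onD[OF D(6), of "j - r" "k - r"] by (auto simp: f'_def)
  qed
  moreover have "i' (k + 1) - i' k \<le> 1 \<and> ({j \<in> {1..m}. f' j = k} = {} \<longrightarrow> i' (k + 1) - i' k = 1)"
    if k: "k \<in> {1..<Suc d}" for k
  proof (cases "k = 1")
    case True
    then have "i' (k + 1) - i' k = \<epsilon>" using D(2) assms(5) by (simp add: i'_def)
    moreover have "r = 0" if "{j \<in> {1..m}. f' j = k} = {}"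
    proof (rule ccontr)
      assume "r \<noteq> 0"
      then have "1 \<in> {j \<in> {1..m}. f' j = k}" using assms(3) True by (auto simp: f'_def)
      then show False using that by blast
    qed
    ultimately show ?thesis using assms(2,4) by auto
  next
    case False
    then have *: "i' (k + 1) - i' k = i (k - 1 + 1) - i (k - 1)" using k by (simp add: i'_def)
    have "{j \<in> {1..m - r}. f j = k - 1} = {}" if e: "{j \<in> {1..m}. f' j = k} = {}"
    proof (rule ccontr)
      assume "{j \<in> {1..m - r}. f j = k - 1} \<noteq> {}"
      then obtain j where "j \<in> {1..m - r}" "f j = k - 1" by auto
      then have "j + r \<in> {j \<in> {1..m}. f' j = k}" using False k by (auto simp: f'_def)
      then show False using e by blast
    qed
    moreover have "k - 1 \<in> {1..<d}" using k False by auto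
    ultimately show ?thesis unfolding * using D(7,8)[of "k - 1"] by blast
  qed
  ultimately have "(i', f') \<in> index_pairs n m (Suc d)"
    using i'_in unfolding index_pairs_def diff_Suc_1 by blast
  then show "cons_pair m d \<epsilon> r (i, f) \<in> index_pairs n m (Suc d)"
    by (simp add: cons_pair_def i'_def f'_def)
  have "{j \<in> {1..m}. f' j = 1} = {1..r}"
  proof (intro set_eqI)
    fix j
    show "j \<in> {j \<in> {1..m}. f' j = 1} \<longleftrightarrow> j \<in> {1..r}"
    proof (cases "j - r \<in> {1..m - r}")
      case True
      then show ?thesis using fpos(1)[OF True] by (auto simp: f'_def)
    qed (use assms(3) in \<open>auto simp: f'_def\<close>)
  qed
  moreover have "i' 2 - 1 = \<epsilon>" using D(2) assms(5) by (simp add: i'_def)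
  ultimately show "first_step m (cons_pair m d \<epsilon> r (i, f)) = (\<epsilon>, r)"
    unfolding cons_pair_def first_step_def i'_def[symmetric] f'_def[symmetric] prod.case
    using assms(3) by simp
qed

lemma cons_pair_tail_pair:
  assumes "(i, f) \<in> index_pairs n m (Suc d)" "first_step m (i, f) = (\<epsilon>, r)" "d \<ge> 1"
  shows "cons_pair m d \<epsilon> r (tail_pair m d \<epsilon> r (i, f)) = (i, f)"
proof -
  note D = index_pairs_D[OF assms(1)]
  note F = first_stepD[OF assms]
  have A: "restrict (\<lambda>k. if k = 1 then 1 else restrict (\<lambda>k. i (k + 1) - \<epsilon>) {1..d} (k - 1) + \<epsilon>) {1..Suc d} k = i k" for k
  proof (cases "k \<in> {1..Suc d}")
    case True
    then show ?thesis using F(5)[of "k - 1"] D(2) by (cases "k = 1") auto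
  qed (use D(1) in \<open>auto simp: PiE_iff extensional_def\<close>)
  have B: "restrict (\<lambda>j. if j \<le> r then 1 else restrict (\<lambda>j. f (j + r) - 1) {1..m - r} (j - r) + 1) {1..m} j = f j" for j
  proof (cases "j \<in> {1..m}")
    case True
    then show ?thesis using F(6)[of j] F(7)[of "j - r"] by (cases "j \<le> r") auto
  qed (use D(5) in \<open>auto simp: PiE_iff extensional_def\<close>)
  show ?thesis
    unfolding cons_pair_def tail_pair_def prod.case prod.inject by (intro conjI ext A B)
qed

lemma tail_pair_cons_pair:
  assumes "(i, f) \<in> index_pairs (n - \<epsilon>) (m - r) d"
  shows "tail_pair m d \<epsilon> r (cons_pair m d \<epsilon> r (i, f)) = (i, f)"
proof -
  note D = index_pairs_D[OF assms]
  have A: "restrict (\<lambda>k. restrict (\<lambda>k. if k = 1 then 1 else i (k - 1) + \<epsilon>) {1..Suc d} (k + 1) - \<epsilon>) {1..d} k = i k" for k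
    using D(1) by (auto simp: PiE_iff extensional_def)
  have B: "restrict (\<lambda>j. restrict (\<lambda>j. if j \<le> r then 1 else f (j - r) + 1) {1..m} (j + r) - 1) {1..m - r} j = f j" for j
    using D(5) by (auto simp: PiE_iff extensional_def)
  show ?thesis
    unfolding cons_pair_def tail_pair_def prod.case prod.inject by (intro conjI ext A B)
qed

section \<open>The recursion for the sums over index pairs\<close>

definition step_sum :: "nat \<Rightarrow> nat list \<Rightarrow> complex list \<Rightarrow> complex falg" where
  "step_sum d b a = (\<Sum>(i, f)\<in>index_pairs (length a) (length b) d. tri_term b a d i f)"

lemma step_sum_Nil: "d \<ge> 1 \<Longrightarrow> step_sum d b [] = 0"
proof -
  assume "d \<ge> 1"
  then have "index_pairs 0 (length b) d = {}"
    by (force simp: index_pairs_def PiE_iff)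
  then show ?thesis by (simp add: step_sum_def)
qed

lemma step_sum_1: "step_sum 1 b a = (if length a = 1 \<and> b = [] then word a else 0)"
proof (cases "length a = 1 \<and> b = []")
  case True
  then obtain z where z: "a = [z]" by (auto simp: length_Suc_conv)
  have "index_pairs (length a) (length b) 1 = {(\<lambda>k\<in>{1..1}. 1, \<lambda>_. undefined)}"
  proof (intro equalityI subsetI)
    fix x assume "x \<in> index_pairs (length a) (length b) 1"
    then obtain i f where x: "x = (i, f)" "i \<in> {1..1} \<rightarrow>\<^sub>E {1}" "f \<in> {} \<rightarrow>\<^sub>E {}"
      using True by (auto simp: index_pairs_def)
    then show "x \<in> {(\<lambda>k\<in>{1..1}. 1, \<lambda>_. undefined)}"
      by (auto simp: PiE_iff extensional_def fun_eq_iff)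
  qed (use True in \<open>auto simp: index_pairs_def mono_on_def\<close>)
  then show ?thesis using True z by (simp add: step_sum_def tri_term_def)
next
  case False
  have "index_pairs (length a) (length b) 1 = {}"
  proof (rule ccontr)
    assume "index_pairs (length a) (length b) 1 \<noteq> {}"
    then obtain i f where D: "(i, f) \<in> index_pairs (length a) (length b) 1" by auto
    \<comment> \<open>For d = 1 the values of \<open>f\<close> lie in the empty set
      \<open>{1..0}\<close>.\<close>
    have "length b = 0"
      using PiE_mem[OF index_pairs_D(5)[OF D], of 1] by (cases "length b = 0") (auto simp: Suc_le_eq)
    moreover have "length a = 1" using index_pairs_D(2,3)[OF D] by simp
    ultimately show False using False by simp
  qed
  then show ?thesis using False by (auto simp: step_sum_def)
qed

definition step_coeff :: "nat list \<Rightarrow> nat \<Rightarrow> nat \<Rightarrow> complex falg" where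
  "step_coeff b \<epsilon> r = (if r = 0 then 1 else U (\<epsilon> + sum_list (take r b) - 1))"

definition step_refl :: "nat list \<Rightarrow> nat \<Rightarrow> complex list \<Rightarrow> complex list" where
  "step_refl b r a = map (refl_letter (\<Sum>x\<leftarrow>take r b. x - 1)) a"

text \<open>The index pairs are grouped by their first step; \<open>tail_pair\<close> and
  \<open>cons_pair\<close> identify each group with the index pairs of the shortened words.\<close>

lemma step_sum_Suc:
  assumes "d \<ge> 1" "a \<noteq> []"
  shows "step_sum (Suc d) b a =
    (\<Sum>(\<epsilon>, r)\<in>({0, 1} \<times> {..length b}) - {(0, 0)}.
       word [hd a] * step_coeff b \<epsilon> r * step_sum d (drop r b) (step_refl b r (drop \<epsilon> a)))"
proof -
  let ?T = "({0, 1 :: nat} \<times> {..length b}) - {(0, 0)}"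
  let ?I = "index_pairs (length a) (length b) (Suc d)"
  let ?g = "\<lambda>(i, f). tri_term b a (Suc d) i f"
  have "first_step (length b) ` ?I \<subseteq> ?T"
  proof (rule image_subsetI)
    fix x assume x: "x \<in> ?I"
    obtain i f \<epsilon> r where *: "x = (i, f)" "first_step (length b) (i, f) = (\<epsilon>, r)"
      by (metis surj_pair)
    then show "first_step (length b) x \<in> ?T"
      using first_stepD(2,3,4)[OF x[unfolded *(1)] *(2) assms(1)] by auto
  qed
  then have "step_sum (Suc d) b a = (\<Sum>y\<in>?T. sum ?g {x \<in> ?I. first_step (length b) x = y})"
    unfolding step_sum_def by (intro sum.group[symmetric] finite_index_pairs) auto
  also have "\<dots> = (\<Sum>(\<epsilon>, r)\<in>?T.
       word [hd a] * step_coeff b \<epsilon> r * step_sum d (drop r b) (step_refl b r (drop \<epsilon> a)))"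
  proof (intro sum.cong refl)
    fix y assume "y \<in> ?T"
    moreover obtain \<epsilon> r where y: "y = (\<epsilon>, r)" by (cases y)
    ultimately have T: "\<epsilon> \<in> {0, 1}" "r \<in> {..length b}" and ne: "\<not> (\<epsilon> = 0 \<and> r = 0)"
      by auto
    let ?J = "index_pairs (length a - \<epsilon>) (length b - r) d"
    let ?h = "\<lambda>(i, f). word [hd a] * step_coeff b \<epsilon> r *
      tri_term (drop r b) (step_refl b r (drop \<epsilon> a)) d i f"
    have "sum ?g {x \<in> ?I. first_step (length b) x = (\<epsilon>, r)} = sum ?h ?J"
    proof (rule sum.reindex_bij_witness[where i = "cons_pair (length b) d \<epsilon> r"
            and j = "tail_pair (length b) d \<epsilon> r"])
      fix x assume x: "x \<in> {x \<in> ?I. first_step (length b) x = (\<epsilon>, r)}"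
      obtain i f where x': "x = (i, f)" by (cases x)
      then have m: "(i, f) \<in> ?I" "first_step (length b) (i, f) = (\<epsilon>, r)" using x by auto
      show "cons_pair (length b) d \<epsilon> r (tail_pair (length b) d \<epsilon> r x) = x"
        unfolding x' by (rule cons_pair_tail_pair[OF m assms(1)])
      show J: "tail_pair (length b) d \<epsilon> r x \<in> ?J"
        unfolding x' by (rule tail_pair_in[OF m assms(1)])
      define i' where "i' = restrict (\<lambda>k. i (k + 1) - \<epsilon>) {1..d}"
      define f' where "f' = restrict (\<lambda>j. f (j + r) - 1) {1..length b - r}"
      have t: "tail_pair (length b) d \<epsilon> r x = (i', f')"
        by (simp add: x' tail_pair_def i'_def f'_def)
      note D' = index_pairs_D[OF J[unfolded t]]
      note F = first_stepD[OF m assms(1)]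
      have "tri_term b a (Suc d) i f =
          word [hd a] * step_coeff b \<epsilon> r * tri_term (drop r b) (step_refl b r (drop \<epsilon> a)) d i' f'"
        unfolding step_coeff_def step_refl_def
      proof (rule tri_term_split_first[OF _ assms])
        show "i 1 = 1" "i' 1 = 1" using index_pairs_D(2)[OF m(1)] D'(2) by auto
        show "i (k + 1) = i' k + \<epsilon>" if "k \<in> {1..d}" for k
          using F(5)[OF that] that by (simp add: i'_def)
        show "i' k \<in> {1..length a - \<epsilon>}" if "k \<in> {1..d}" for k
          using D'(1) that by (rule PiE_mem)
        show "f j = 1" if "j \<in> {1..r}" for j using F(6)[OF that] .
        show "f (j + r) = f' j + 1" if "j \<in> {1..length b - r}" for j
          using F(7)[OF that] that by (simp add: f'_def)
        show "f' j \<ge> 1" if "j \<in> {1..length b - r}" for j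
          using PiE_mem[OF D'(5) that] by simp
      qed (use T in auto)
      then show "?h (tail_pair (length b) d \<epsilon> r x) = ?g x"
        by (simp only: t) (simp add: x')
    next
      fix y assume y: "y \<in> ?J"
      obtain i f where y': "y = (i, f)" by (cases y)
      note c = cons_pair_in[OF y[unfolded y'] _ _ _ assms(1)]
      show "tail_pair (length b) d \<epsilon> r (cons_pair (length b) d \<epsilon> r y) = y"
        unfolding y' by (rule tail_pair_cons_pair[OF y[unfolded y']])
      show "cons_pair (length b) d \<epsilon> r y \<in> {x \<in> ?I. first_step (length b) x = (\<epsilon>, r)}"
        unfolding y' using c T ne by auto
    qed
    also have "\<dots> = word [hd a] * step_coeff b \<epsilon> r * step_sum d (drop r b) (step_refl b r (drop \<epsilon> a))"
      by (simp add: step_sum_def step_refl_def sum_distrib_left case_prod_unfold)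
    finally show "sum ?g {x \<in> ?I. first_step (length b) x = y} =
      (case y of (\<epsilon>, r) \<Rightarrow>
        word [hd a] * step_coeff b \<epsilon> r * step_sum d (drop r b) (step_refl b r (drop \<epsilon> a)))"
      by (simp only: y prod.case)
  qed
  finally show ?thesis .
qed

text \<open>Each step raises \<open>i\<close> by at most one, and it raises \<open>i\<close> or uses
  up a letter of \<open>b\<close>; this bounds \<open>d\<close> from both sides. The vanishing
  allows words of different lengths to share one summation range.\<close>

lemma step_sum_eq_0:
  assumes "d \<ge> 1" "d < length a \<or> d > length a + length b"
  shows "step_sum d b a = 0"
  using assms
proof (induction d arbitrary: a b)
  case (Suc d)
  show ?case
  proof (cases "d = 0 \<or> a = []")
    case True
    then show ?thesis using Suc.prems step_sum_1[of b a] step_sum_Nil[of "Suc d" b] by auto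
  next
    case False
    then have "d \<ge> 1" "length a \<ge> 1" by (auto simp: Suc_le_eq)
    then have "step_sum d (drop r b) (step_refl b r (drop \<epsilon> a)) = 0"
      if "\<epsilon> \<in> {0, 1}" "r \<le> length b" "\<not> (\<epsilon> = 0 \<and> r = 0)" for \<epsilon> r
      using that Suc.prems(2) by (intro Suc.IH) (auto simp: step_refl_def)
    then have *: "word [hd a] * step_coeff b \<epsilon> r * step_sum d (drop r b) (step_refl b r (drop \<epsilon> a)) = 0"
      if "(\<epsilon>, r) \<in> ({0, 1} \<times> {..length b}) - {(0, 0)}" for \<epsilon> r
      using that by simp
    show ?thesis
      unfolding step_sum_Suc[OF \<open>d \<ge> 1\<close> conjunct2[OF False[unfolded de_Morgan_disj]]]
    proof (intro sum.neutral ballI)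
      fix y assume "y \<in> ({0, 1 :: nat} \<times> {..length b}) - {(0, 0)}"
      then show "(case y of (\<epsilon>, r) \<Rightarrow>
          word [hd a] * step_coeff b \<epsilon> r * step_sum d (drop r b) (step_refl b r (drop \<epsilon> a))) = 0"
        using * by (cases y) (simp only: prod.case)
    qed
  qed
qed simp

text \<open>The exponent is a sum of the same parity as the original difference, and the range no
  longer depends on the words. In this form the recursion can be applied under the sum.\<close>

lemma tri_word_eq_step_sum:
  assumes "N \<ge> length a + length b"
  shows "tri_word b a = (\<Sum>d = 1..N. (- 1) ^ (length a + length b + d) * step_sum d b a)"
proof (cases "a = []")
  case False
  have "tri_word b a = (\<Sum>d = length a..length a + length b. (- 1) ^ (length a + length b + d) * step_sum d b a)"
    using False unfolding tri_word_def step_sum_def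
    by (auto intro!: sum.cong arg_cong2[of _ _ _ _ "(*)"] simp: minus_one_power_iff)
  also have "\<dots> = (\<Sum>d = 1..N. (- 1) ^ (length a + length b + d) * step_sum d b a)"
    using False assms
    by (intro sum.mono_neutral_left) (auto simp: step_sum_eq_0 Suc_le_eq)
  finally show ?thesis .
qed (simp add: tri_word_def step_sum_Nil)

lemma neg_one_power_mult_commute: "p * ((- 1) ^ k * q) = (- 1) ^ k * (p * q :: 'a :: ring_1)"
  by (simp add: minus_one_power_iff)

lemma tri_word_first_step:
  assumes "a \<noteq> []"
  shows "tri_word b a = (if length a = 1 \<and> b = [] then word a else 0) +
    (\<Sum>(\<epsilon>, r)\<in>({0, 1} \<times> {..length b}) - {(0, 0)}. (- 1) ^ (\<epsilon> + r + 1) *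
       (word [hd a] * step_coeff b \<epsilon> r * tri_word (drop r b) (step_refl b r (drop \<epsilon> a))))"
proof -
  let ?N = "length a + length b"
  let ?T = "({0, 1 :: nat} \<times> {..length b}) - {(0, 0)}"
  have "tri_word b a = (\<Sum>d = 1..Suc ?N. (- 1) ^ (?N + d) * step_sum d b a)"
    by (rule tri_word_eq_step_sum) simp
  also have "\<dots> = (- 1) ^ (?N + 1) * step_sum 1 b a +
      (\<Sum>d = 1..?N. (- 1) ^ (?N + Suc d) * step_sum (Suc d) b a)"
    using sum.atLeast_Suc_atMost[of 1 "Suc ?N" "\<lambda>d. (- 1) ^ (?N + d) * step_sum d b a"]
      sum.atLeast_Suc_atMost_Suc_shift[of "\<lambda>d. (- 1) ^ (?N + d) * step_sum d b a" 1 ?N]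
    by (simp only: Suc_eq_plus1_left[symmetric] One_nat_def o_def)
  finally have split: "tri_word b a = (- 1) ^ (?N + 1) * step_sum 1 b a +
      (\<Sum>d = 1..?N. (- 1) ^ (?N + Suc d) * step_sum (Suc d) b a)" .
  have first: "(- 1) ^ (?N + 1) * step_sum 1 b a = (if length a = 1 \<and> b = [] then word a else 0)"
    unfolding step_sum_1 by auto
  have "(\<Sum>d = 1..?N. (- 1) ^ (?N + Suc d) * step_sum (Suc d) b a) =
     (\<Sum>d = 1..?N. \<Sum>(\<epsilon>, r)\<in>?T. (- 1) ^ (?N + Suc d) *
        (word [hd a] * step_coeff b \<epsilon> r * step_sum d (drop r b) (step_refl b r (drop \<epsilon> a))))"
    using assms by (intro sum.cong refl) (simp add: step_sum_Suc sum_distrib_left case_prod_unfold)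
  also have "\<dots> = (\<Sum>(\<epsilon>, r)\<in>?T. \<Sum>d = 1..?N. (- 1) ^ (?N + Suc d) *
        (word [hd a] * step_coeff b \<epsilon> r * step_sum d (drop r b) (step_refl b r (drop \<epsilon> a))))"
    unfolding case_prod_unfold by (rule sum.swap)
  also have "\<dots> = (\<Sum>(\<epsilon>, r)\<in>?T. (- 1) ^ (\<epsilon> + r + 1) *
       (word [hd a] * step_coeff b \<epsilon> r * tri_word (drop r b) (step_refl b r (drop \<epsilon> a))))"
  proof (intro sum.cong refl)
    fix y assume "y \<in> ?T"
    then obtain \<epsilon> r where y: "y = (\<epsilon>, r)" and T: "\<epsilon> \<in> {0, 1}" "r \<in> {..length b}" by auto
    have len: "length a \<ge> 1" using assms by (simp add: Suc_le_eq)
    have "tri_word (drop r b) (step_refl b r (drop \<epsilon> a)) =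
      (\<Sum>d = 1..?N. (- 1) ^ (length a - \<epsilon> + (length b - r) + d) *
         step_sum d (drop r b) (step_refl b r (drop \<epsilon> a)))"
      by (subst tri_word_eq_step_sum[of _ _ ?N]) (simp_all add: step_refl_def)
    moreover have "(- 1 :: complex falg) ^ (?N + Suc d) =
        (- 1) ^ (\<epsilon> + r + 1) * (- 1) ^ (length a - \<epsilon> + (length b - r) + d)" for d
    proof -
      \<comment> \<open>The truncated differences are exact because \<epsilon> \<le>
        \<open>length a\<close> and r \<le> \<open>length b\<close>.\<close>
      have "even (?N + Suc d) \<longleftrightarrow> even (\<epsilon> + r + 1 + (length a - \<epsilon> + (length b - r) + d))"
        using T len by auto
      then have "(- 1 :: complex falg) ^ (?N + Suc d) =
          (- 1) ^ (\<epsilon> + r + 1 + (length a - \<epsilon> + (length b - r) + d))"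
        by (simp only: minus_one_power_iff)
      then show ?thesis unfolding power_add[of _ "\<epsilon> + r + 1"] .
    qed
    moreover define P where "P = word [hd a] * step_coeff b \<epsilon> r"
    ultimately show "(case y of (\<epsilon>, r) \<Rightarrow> \<Sum>d = 1..?N. (- 1) ^ (?N + Suc d) *
        (word [hd a] * step_coeff b \<epsilon> r * step_sum d (drop r b) (step_refl b r (drop \<epsilon> a)))) =
      (case y of (\<epsilon>, r) \<Rightarrow> (- 1) ^ (\<epsilon> + r + 1) *
       (word [hd a] * step_coeff b \<epsilon> r * tri_word (drop r b) (step_refl b r (drop \<epsilon> a))))"
      unfolding y prod.case P_def[symmetric]
      by (simp only: sum_distrib_left neg_one_power_mult_commute[of P] mult.assoc)
  qed
  finally show ?thesis unfolding split first by (rule arg_cong)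
qed

section \<open>Block sums and the recursion on words\<close>

lemma tri_word_Nil_right [simp]: "tri_word b [] = 0"
  by (simp add: tri_word_def)

lemma tri_word_Nil_left: "tri_word [] a = (if a = [] then 0 else word a)"
proof (induction a)
  case (Cons z a)
  \<comment> \<open>With no letters in \<open>b\<close>, the only step goes to the next letter of
    \<open>a\<close>.\<close>
  have "({0, 1} \<times> {..length []}) - {(0, 0)} = {(1 :: nat, 0 :: nat)}" by auto
  then have "tri_word [] (z # a) = (if a = [] then word [z] else 0) + word [z] * tri_word [] a"
    by (subst tri_word_first_step) (simp_all add: step_coeff_def step_refl_def)
  then show ?case using Cons by (simp add: word_Cons[of z a] del: mult_cancel_left1)
      (simp add: word_Nil)?
qed simp

text \<open>The alternating sum over the initial blocks cut off from \<open>b\<close>, where \<open>f\<close> is either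
  \<open>U\<close> or its antisymmetric analogue \<open>alt_diff\<close> below. The block is removed letter by letter, so that
  the weight accumulates in the argument \<open>k\<close> of \<open>f\<close>.\<close>

primrec blk :: "(nat \<Rightarrow> complex falg) \<Rightarrow> nat list \<Rightarrow> nat \<Rightarrow> complex list \<Rightarrow> complex falg" where
  "blk f [] k a = f k * tri_word [] a"
| "blk f (x # b) k a = f k * tri_word (x # b) a - blk f b (k + x) (map (refl_letter (x - 1)) a)"

lemma blk_eq_sum:
  "blk f b k a = (\<Sum>q\<le>length b. (- 1) ^ q * (f (k + sum_list (take q b)) * tri_word (drop q b) (step_refl b q a)))"
proof (induction b arbitrary: k a)
  case (Cons x b)
  have "step_refl b q (map (refl_letter (x - 1)) a) = step_refl (x # b) (Suc q) a" for q
    by (simp add: step_refl_def refl_letter_add add.commute)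
  then show ?case
    by (simp del: sum.atMost_Suc add: sum.atMost_Suc_shift Cons sum_negf add.assoc)
      (simp add: step_refl_def)
qed (simp add: step_refl_def)

text \<open>A first step that takes nothing from \<open>b\<close> must move on in \<open>a\<close>,
  which gives the first summand. Steps that take a block form the two block sums: the first stays at
  \<open>z\<close>, the second moves on and so has one more in the argument of U and the opposite
  sign.\<close>

lemma tri_word_Cons:
  assumes "x \<ge> 1"
  shows "tri_word (x # b) (z # a) = word [z] * (tri_word (x # b) a
    + blk U b (x - 1) (map (refl_letter (x - 1)) (z # a)) - blk U b x (map (refl_letter (x - 1)) a))"
proof -
  let ?F = "\<lambda>\<epsilon> r. (- 1) ^ (\<epsilon> + r + 1) * (word [z] * step_coeff (x # b) \<epsilon> r *
    tri_word (drop r (x # b)) (step_refl (x # b) r (drop \<epsilon> (z # a))))"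
  have blk: "(\<Sum>r\<in>{1..length (x # b)}. ?F \<epsilon> r) =
     (- 1) ^ \<epsilon> * (word [z] * blk U b (x + \<epsilon> - 1) (map (refl_letter (x - 1)) (drop \<epsilon> (z # a))))" for \<epsilon>
  proof -
    have "step_refl b q (map (refl_letter (x - 1)) a) = step_refl (x # b) (Suc q) a" for q a
      by (simp add: step_refl_def refl_letter_add add.commute)
    moreover have "\<epsilon> + (x + s) - Suc 0 = x + \<epsilon> - 1 + s" for s using assms by simp
    moreover have "(\<Sum>r\<in>{1..length (x # b)}. ?F \<epsilon> r) = (\<Sum>q\<le>length b. ?F \<epsilon> (Suc q))"
      by (simp only: One_nat_def list.size sum.atLeast_Suc_atMost_Suc_shift o_def atMost_atLeast0 add_0_right add_Suc_right)
    ultimately show ?thesis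
      unfolding blk_eq_sum sum_distrib_left
      by (auto intro!: sum.cong simp: step_coeff_def minus_one_power_iff mult.assoc)
  qed
  have "tri_word (x # b) (z # a) = (\<Sum>(\<epsilon>, r)\<in>({0, 1} \<times> {..length (x # b)}) - {(0, 0)}. ?F \<epsilon> r)"
    by (subst tri_word_first_step) simp_all
  also have "({0, 1} \<times> {..length (x # b)}) - {(0, 0)} =
      insert (1, 0) ({0, 1 :: nat} \<times> {1..length (x # b)})"
    by auto
  also have "(\<Sum>(\<epsilon>, r)\<in>\<dots>. ?F \<epsilon> r) = ?F 1 0 + (\<Sum>r\<in>{1..length (x # b)}. ?F 0 r) + (\<Sum>r\<in>{1..length (x # b)}. ?F 1 r)"
    by (subst sum.insert) (auto simp flip: sum.cartesian_product)
  also have "?F 1 0 = word [z] * tri_word (x # b) a"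
    by (simp add: step_coeff_def step_refl_def)
  finally show ?thesis unfolding blk by (simp add: algebra_simps)
qed

subsection \<open>Alternating words\<close>

definition alt_diff :: "nat \<Rightarrow> complex falg" where
  "alt_diff k = word (alt_word 0 k) - word (alt_word 1 k)"

lemma alt_diff_0 [simp]: "alt_diff 0 = 0"
  by (simp add: alt_diff_def)

lemma alt_word_append: "alt_word x k @ alt_word (refl_letter k x) j = alt_word x (k + j)"
proof (induction k arbitrary: x)
  case (Suc k)
  have "refl_letter (Suc k) x = refl_letter k (1 - x)" by (simp add: refl_letter_def)
  then show ?case using Suc[of "1 - x"] by simp
qed simp

lemma word_alt_mult:
  "word (alt_word x k) * word (alt_word (refl_letter k x) j) = word (alt_word x (k + j))"
  by (simp add: alt_word_append flip: word_append)

lemma scal_2: "scal 2 p = p + p"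
  using falg.scale_left_distrib[of 1 1 p] by simp

text \<open>Of the four products of alternating words, the two that are not alternating across the
  seam cancel. Which two these are depends on the parity of k, hence the sign.\<close>

lemma U_mult_alt_diff:
  "U k * alt_diff j + scal ((- 1) ^ k) (alt_diff k * U j) = scal (2 * (- 1) ^ k) (alt_diff (k + j))"
  using word_alt_mult[of 0 k j] word_alt_mult[of 1 k j]
  by (cases "even k")
     (simp_all add: U_def alt_diff_def refl_letter_def falg_simps scal_2 algebra_simps)

text \<open>In a block sum only the argument of the leading factor grows; what follows it is the
  same for U and A. The identity for products therefore lifts summand by summand.\<close>

lemma U_mult_blk:
  "U k * blk alt_diff b j a + scal ((- 1) ^ k) (alt_diff k * blk U b j a) = scal (2 * (- 1) ^ k) (blk alt_diff b (k + j) a)"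
proof (induction b arbitrary: j a)
  case Nil
  then show ?case
    using arg_cong[OF U_mult_alt_diff[of k j], of "\<lambda>p. p * tri_word [] a"] by (simp add: falg_simps mult.assoc)
next
  case (Cons x b)
  show ?case
    using arg_cong[OF U_mult_alt_diff[of k j], of "\<lambda>p. p * tri_word (x # b) a"]
      Cons[of "j + x" "map (refl_letter (x - 1)) a"]
    by (simp add: falg_simps mult.assoc add.assoc algebra_simps)
qed

lemma blk_Nil_right [simp]: "blk f b k [] = 0"
  by (induction b arbitrary: k) simp_all

lemma blk_Nil_left: "blk f [] k = (\<lambda>a. f k * tri_word [] a)"
  by (rule ext) simp

lemma blk_Cons: "blk f (x # b) k =
    (\<lambda>a. f k * tri_word (x # b) a - blk f b (k + x) (map (refl_letter (x - 1)) a))"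
  by (rule ext) simp

text \<open>For empty \<open>b\<close> the value is \<open>word a\<close> and not
  \<open>tri_word [] a\<close>: at empty \<open>a\<close> the rest is the constant 1, while
  \<open>tri_word [] []\<close> is 0.\<close>

definition tri_rest :: "complex \<Rightarrow> nat list \<Rightarrow> complex list \<Rightarrow> complex falg" where
  "tri_rest z b a = (case b of [] \<Rightarrow> word a | x # b \<Rightarrow> tri_word (x # b) a
    + blk U b (x - 1) (map (refl_letter (x - 1)) (z # a)) - blk U b x (map (refl_letter (x - 1)) a))"

lemma tri_word_eq_rest:
  assumes "\<forall>x\<in>set b. 1 \<le> x"
  shows "tri_word b (z # a) = word [z] * tri_rest z b a"
  using assms by (cases b) (simp_all add: tri_rest_def tri_word_Nil_left tri_word_Cons word_Cons[of z a])

subsection \<open>The derivation\<close>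

text \<open>Symmetry and invariance under simultaneous reflection are the properties of
  \<open>Delta\<close> from which the cancellations come.\<close>

locale pair_weight =
  fixes D :: "complex \<Rightarrow> complex \<Rightarrow> rat"
  assumes D_sym: "D x y = D y x" and D_reflect: "D (1 - x) (1 - y) = D x y"
begin

fun left_del_word :: "complex \<Rightarrow> complex list \<Rightarrow> complex falg" where
  "left_del_word z (x # y # w) =
     scal (D x y - D x z) (word (y # w)) + word [x] * left_del_word x (y # w)"
| "left_del_word z _ = 0"

text \<open>Applying \<open>g\<close> to the shortened words covers both sides of the theorem:
  \<open>g = word\<close> gives the derivation itself, and \<open>g = tri_word b\<close> gives the
  operation applied to the derivative of \<open>a\<close>. Under the recursion a passed letter is
  absorbed into \<open>g\<close>.\<close>

fun deriv :: "(complex list \<Rightarrow> complex falg) \<Rightarrow> complex list \<Rightarrow> complex falg" where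
  "deriv g (x # y # y' # w) =
     scal (D y y' - D y x) (g (x # y' # w)) + deriv (\<lambda>u. g (x # u)) (y # y' # w)"
| "deriv g _ = 0"

definition left_del :: "complex \<Rightarrow> complex falg \<Rightarrow> complex falg" where
  "left_del z = lin_ext (left_del_word z)"

definition head_weight :: "complex \<Rightarrow> complex falg \<Rightarrow> complex falg" where
  "head_weight z = lin_ext (\<lambda>u. if u = [] then 0 else scal (D z (hd u)) (word u))"

definition nonempty_part :: "complex falg \<Rightarrow> complex falg" where
  "nonempty_part = lin_ext (\<lambda>u. if u = [] then 0 else word u)"

text \<open>The parts of \<open>D z\<close> that are even and odd under exchanging 0 and 1;
  reflecting z fixes the first and negates the second.\<close>

definition avg :: "complex \<Rightarrow> rat" where "avg z = (D z 0 + D z 1) / 2"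
definition dif :: "complex \<Rightarrow> rat" where "dif z = (D z 0 - D z 1) / 2"
definition bdry :: "complex \<Rightarrow> rat" where "bdry z = 2 * avg z - 2 * D z z"

lemma D_0: "D z 0 = avg z + dif z" "D 0 z = avg z + dif z"
  and D_1: "D z 1 = avg z - dif z" "D 1 z = avg z - dif z"
  using D_sym[of 0 z] D_sym[of 1 z] by (simp_all add: avg_def dif_def field_simps)

lemma D_refl_letter [simp]: "D (refl_letter j x) (refl_letter j y) = D x y"
  by (simp add: refl_letter_def D_reflect)

lemma avg_refl_letter [simp]: "avg (refl_letter j z) = avg z"
  using D_reflect[of z 0] D_reflect[of z 1] by (auto simp: refl_letter_def avg_def)

lemma dif_refl_letter: "dif (refl_letter j z) = (- 1) ^ j * dif z"
  using D_reflect[of z 0] D_reflect[of z 1] by (auto simp: refl_letter_def dif_def minus_one_power_iff field_simps)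

lemma bdry_refl_letter [simp]: "bdry (refl_letter j z) = bdry z"
  by (simp add: bdry_def)

lemmas op_defs = left_del_def head_weight_def nonempty_part_def

section \<open>Deletion operators on words and products\<close>

lemma deriv_hom:
  assumes "module_hom scal scal f"
  shows "f (deriv g w) = deriv (\<lambda>u. f (g u)) w"
  by (induction g w rule: deriv.induct)
     (simp_all add: module_hom.add[OF assms] module_hom.scale[OF assms] module_hom.zero[OF assms])

lemma deriv_mult: "deriv (\<lambda>u. p * g u) w = p * deriv g w"
  by (rule deriv_hom[OF hom_mult_left, symmetric])

lemma deriv_add: "deriv (\<lambda>u. g u + h u) w = deriv g w + deriv h w"
  by (induction g w arbitrary: h rule: deriv.induct) (simp_all add: falg_simps)

lemma deriv_diff: "deriv (\<lambda>u. g u - h u) w = deriv g w - deriv h w"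
  by (induction g w arbitrary: h rule: deriv.induct) (simp_all add: falg_simps)

lemma deriv_Cons2: "deriv g (x # y # w) =
    (if w = [] then 0 else scal (D y (hd w) - D y x) (g (x # w))) + deriv (\<lambda>u. g (x # u)) (y # w)"
  by (cases w) simp_all

lemma deriv_refl_letter:
  "deriv (\<lambda>u. g (map (refl_letter j) u)) w = deriv g (map (refl_letter j) w)"
proof (induction w arbitrary: g)
  case (Cons x v)
  then show ?case
    using Cons[of "\<lambda>u. g (refl_letter j x # u)"] by (cases v) (auto simp: deriv_Cons2 hd_map)
qed simp

lemma deriv_word_Cons: "deriv word (z # w) = word [z] * left_del_word z w"
proof (induction z w rule: left_del_word.induct)
  case (1 z x y w)
  have "deriv (\<lambda>u. word (z # u)) (x # y # w) = word [z] * deriv word (x # y # w)"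
    by (subst word_Cons) (rule deriv_mult)
  then show ?case
    using 1 by (simp add: falg_simps mult.assoc flip: word_append)
qed simp_all

lemma lin_ext_deriv_Cons: "lin_ext (deriv word) (word [z] * p) = word [z] * left_del z p"
  by (induction p rule: falg_induct)
     (simp_all add: falg_simps left_del_def deriv_word_Cons flip: word_append)

text \<open>A letter is deleted only if it has a right neighbour. The first letter of
  \<open>p\<close> enters through \<open>head_weight\<close>; the constant term of \<open>p\<close>,
  which would leave \<open>w\<close> in last position, is discarded by
  \<open>nonempty_part\<close>.\<close>

lemma left_del_Cons: "left_del z (word [w] * p) =
    head_weight w p - scal (D w z) (nonempty_part p) + word [w] * left_del w p"
proof (induction p rule: falg_induct)
  case (word c u)
  then show ?case
    by (cases u) (simp_all add: falg_simps op_defs flip: word_append)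
qed (simp_all add: falg_simps op_defs)

lemma head_weight_word_mult: "head_weight z (word (x # u) * p) = scal (D z x) (word (x # u) * p)"
  by (induction p rule: falg_induct)
     (simp_all add: falg_simps head_weight_def mult.commute flip: word_append)

lemma nonempty_part_word_mult: "nonempty_part (word (x # u) * p) = word (x # u) * p"
  by (induction p rule: falg_induct)
     (simp_all add: falg_simps nonempty_part_def flip: word_append)

section \<open>Deletion in alternating words\<close>

text \<open>An inner letter of an alternating word has equal neighbours, so its two weights cancel,
  and only the first and the last letter contribute. For k = 0 these coincide, and the two
  occurrences of \<open>D x (1 - x)\<close> cancel.\<close>

lemma left_del_alt_word:
  "left_del z (word (alt_word x (Suc k)) * (word [w] * r)) =
     scal (D x (1 - x) - D x z) (word (alt_word (1 - x) k) * (word [w] * r))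
   + scal (D w (refl_letter k x) - D x (1 - x)) (word (alt_word x k) * (word [w] * r))
   + word (alt_word x (Suc k)) * left_del (refl_letter k x) (word [w] * r)"
proof (induction k arbitrary: z x)
  case 0
  then show ?case
    using head_weight_word_mult[of x w "[]" r] nonempty_part_word_mult[of w "[]" r] D_sym[of w x]
    by (simp add: left_del_Cons[of z x] falg_simps word_Nil)
next
  case (Suc k)
  have y: "refl_letter k (1 - x) = refl_letter (Suc k) x" by (simp add: refl_letter_def)
  have "left_del z (word (alt_word x (Suc (Suc k))) * (word [w] * r)) =
    left_del z (word [x] * (word (alt_word (1 - x) (Suc k)) * (word [w] * r)))"
    using word_Cons[of x "alt_word (1 - x) (Suc k)"] by (simp add: mult.assoc)
  also have "\<dots> = scal (D x (1 - x) - D x z) (word (alt_word (1 - x) (Suc k)) * (word [w] * r))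
      + word [x] * left_del x (word (alt_word (1 - x) (Suc k)) * (word [w] * r))"
    unfolding left_del_Cons[of z x]
    by (simp add: head_weight_word_mult nonempty_part_word_mult falg_simps)
  also have "\<dots> = scal (D x (1 - x) - D x z) (word (alt_word (1 - x) (Suc k)) * (word [w] * r))
      + word [x] * (scal (D w (refl_letter (Suc k) x) - D x (1 - x)) (word (alt_word (1 - x) k) * (word [w] * r))
      + word (alt_word (1 - x) (Suc k)) * left_del (refl_letter (Suc k) x) (word [w] * r))"
    unfolding Suc[of x "1 - x"] y using D_sym[of "1 - x" x] by simp
  finally show ?case
    using word_Cons[of x "alt_word (1 - x) k"] word_Cons[of x "alt_word (1 - x) (Suc k)"]
    by (simp add: falg_simps mult.assoc)
qed

lemma left_del_diff: "left_del z (p - q) = left_del z p - left_del z q"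
  and left_del_add: "left_del z (p + q) = left_del z p + left_del z q"
  and left_del_scal: "left_del z (scal c p) = scal c (left_del z p)"
  by (simp_all add: left_del_def)

lemma left_del_U: "left_del z (U (Suc k) * (word [w] * r)) =
     scal (avg w - avg z) (U k * (word [w] * r))
   + scal (dif z + (- 1) ^ k * dif w) (alt_diff k * (word [w] * r))
   + U (Suc k) * (head_weight w r - scal (avg w) (nonempty_part r))
   - scal ((- 1) ^ k * dif w) (alt_diff (Suc k) * nonempty_part r)
   + U (Suc k) * (word [w] * left_del w r)"
proof -
  \<comment> \<open>Deleting the first letter of one alternating word leaves the same word as
    deleting the last letter of the other or of itself; in the sum over both words the weights
    \<open>D 0 1\<close> cancel.\<close>
  have "D 0 1 = D 1 0" by (rule D_sym)
  then show ?thesis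
    unfolding U_def distrib_right left_del_add left_del_alt_word left_del_Cons[of _ w]
    by (cases "even k")
       (simp_all add: alt_diff_def refl_letter_def D_0(1)[of w] D_1(1)[of w] D_0(2)[of z] D_1(2)[of z]
          falg_simps del: alt_word.simps)
qed

section \<open>First letters of the summands in the recursion\<close>

lemma head_weight_diff: "head_weight z (p - q) = head_weight z p - head_weight z q"
  and head_weight_add: "head_weight z (p + q) = head_weight z p + head_weight z q"
  and nonempty_part_diff: "nonempty_part (p - q) = nonempty_part p - nonempty_part q"
  and nonempty_part_add: "nonempty_part (p + q) = nonempty_part p + nonempty_part q"
  by (simp_all add: op_defs)

lemma head_weight_tri_word:
  assumes "\<forall>x\<in>set b. 1 \<le> x"
  shows "head_weight z (tri_word b a) = scal (D z (hd a)) (tri_word b a)"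
    and "nonempty_part (tri_word b a) = tri_word b a"
  using assms head_weight_word_mult[of z _ "[]"] nonempty_part_word_mult[of _ "[]"]
  by (cases a; simp add: tri_word_eq_rest; simp add: op_defs)+

lemma head_weight_U_mult: "head_weight z (U (Suc k) * p) =
    scal (avg z) (U (Suc k) * p) + scal (dif z) (alt_diff (Suc k) * p)"
  and nonempty_part_U_mult: "nonempty_part (U (Suc k) * p) = U (Suc k) * p"
  by (simp_all add: U_def alt_diff_def distrib_right left_diff_distrib head_weight_add nonempty_part_add
      head_weight_word_mult nonempty_part_word_mult D_0 D_1 falg_simps)

lemma head_weight_blk:
  "head_weight z (blk U b (Suc k) a) = scal (avg z) (blk U b (Suc k) a) + scal (dif z) (blk alt_diff b (Suc k) a)"
  "nonempty_part (blk U b (Suc k) a) = blk U b (Suc k) a"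
  by (induction b arbitrary: k a)
     (simp_all add: head_weight_U_mult nonempty_part_U_mult head_weight_diff nonempty_part_diff falg_simps)

text \<open>The summand with U(0) = 2 begins with \<open>z\<close> itself instead of 0 or 1, so it
  has weight 2 \<open>D z z\<close> in place of 2 \<open>avg z\<close>. The correction is
  \<open>bdry z\<close>; no such correction arises for the A-sum because A(0) = 0.\<close>

lemma head_weight_blk_0:
  assumes "\<forall>x\<in>set b. 1 \<le> x"
  shows "head_weight z (blk U b 0 (z # a)) = scal (avg z) (blk U b 0 (z # a))
      + scal (dif z) (blk alt_diff b 0 (z # a)) - scal (bdry z) (tri_word b (z # a))"
    and "nonempty_part (blk U b 0 (z # a)) = blk U b 0 (z # a)"
proof -
  have U0: "U 0 * p = p + p" for p by (simp add: U_def word_Nil mult_2)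
  have "head_weight z (blk U b 0 (z # a)) = scal (avg z) (blk U b 0 (z # a))
      + scal (dif z) (blk alt_diff b 0 (z # a)) - scal (bdry z) (tri_word b (z # a)) \<and>
    nonempty_part (blk U b 0 (z # a)) = blk U b 0 (z # a)"
  proof (cases b)
    case Nil
    then show ?thesis
      using head_weight_tri_word(1)[OF assms, of z "z # a"] head_weight_tri_word(2)[OF assms, of "z # a"]
      by (simp add: U0 distrib_right head_weight_add nonempty_part_add bdry_def falg_simps)
        (simp add: scal_2 flip: falg.scale_scale)
  next
    case (Cons x b')
    then obtain k where x: "x = Suc k" using assms by (cases x) auto
    show ?thesis
      using head_weight_tri_word(1)[OF assms, of z "z # a"] head_weight_tri_word(2)[OF assms, of "z # a"] unfolding Cons x
      by (simp add: U0 distrib_right head_weight_add nonempty_part_add head_weight_diff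
          nonempty_part_diff head_weight_blk bdry_def falg_simps)
        (simp add: scal_2 flip: falg.scale_scale)
  qed
  then show "head_weight z (blk U b 0 (z # a)) = scal (avg z) (blk U b 0 (z # a))
      + scal (dif z) (blk alt_diff b 0 (z # a)) - scal (bdry z) (tri_word b (z # a))"
    and "nonempty_part (blk U b 0 (z # a)) = blk U b 0 (z # a)" by auto
qed

lemma head_weight_rest:
  fixes j :: nat
  defines "f \<equiv> map (refl_letter j)"
  assumes "\<forall>x\<in>set b. 1 \<le> x"
  shows "head_weight w (tri_rest w (Suc j # b) a) =
      scal (D w (hd a)) (tri_word (Suc j # b) a)
      + scal (avg w) (blk U b j (f (w # a)) - blk U b (Suc j) (f a))
      + scal (dif w) (blk alt_diff b j (f (w # a)) - blk alt_diff b (Suc j) (f a))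
      - scal (of_bool (j = 0) * bdry w) (tri_word b (w # a))"
    and "nonempty_part (tri_rest w (Suc j # b) a) = tri_rest w (Suc j # b) a"
proof -
  have pos: "\<forall>x\<in>set (Suc j # b). 1 \<le> x" using assms by simp
  have "head_weight w (blk U b j (f (w # a))) = scal (avg w) (blk U b j (f (w # a)))
      + scal (dif w) (blk alt_diff b j (f (w # a)))
      - scal (of_bool (j = 0) * bdry w) (tri_word b (w # a)) \<and>
    nonempty_part (blk U b j (f (w # a))) = blk U b j (f (w # a))"
    using head_weight_blk_0[OF assms(2)] head_weight_blk by (cases j) (auto simp: f_def)
  then show "head_weight w (tri_rest w (Suc j # b) a) =
      scal (D w (hd a)) (tri_word (Suc j # b) a)
      + scal (avg w) (blk U b j (f (w # a)) - blk U b (Suc j) (f a))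
      + scal (dif w) (blk alt_diff b j (f (w # a)) - blk alt_diff b (Suc j) (f a))
      - scal (of_bool (j = 0) * bdry w) (tri_word b (w # a))"
    and "nonempty_part (tri_rest w (Suc j # b) a) = tri_rest w (Suc j # b) a"
    using head_weight_blk head_weight_tri_word[OF pos]
    unfolding tri_rest_def f_def
    by (simp_all add: head_weight_add head_weight_diff nonempty_part_add nonempty_part_diff falg_simps algebra_simps)
qed

text \<open>\<open>left_del_U\<close> produces products of U with A-sums. Exchanging U and A by
  \<open>U_mult_blk\<close> cancels the products of \<open>alt_diff (Suc k)\<close> with U-sums and
  merges the two blocks, so that only A-sums for \<open>x # b\<close> remain. Factors 2 are written
  as repeated summands.\<close>

lemma left_del_U_tri_word:
  assumes pos: "\<forall>x\<in>set b. 1 \<le> x" and x: "x \<ge> 1"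
  shows "left_del z (U (Suc k) * tri_word (x # b) (w # a)) =
     scal (avg w - avg z) (U k * tri_word (x # b) (w # a))
   + scal (dif z + (- 1) ^ k * dif w) (alt_diff k * tri_word (x # b) (w # a))
   + scal (D w (hd a) - avg w) (U (Suc k) * tri_word (x # b) a)
   - scal ((- 1) ^ k * dif w) (blk alt_diff (x # b) (Suc k) a + blk alt_diff (x # b) (Suc k) a
       - alt_diff (Suc k) * tri_word (x # b) a + alt_diff k * tri_word (x # b) (w # a) + alt_diff k * tri_word (x # b) (w # a)
       - blk alt_diff (x # b) k (w # a) - blk alt_diff (x # b) k (w # a))
   - scal (of_bool (x = 1) * bdry w) (U (Suc k) * tri_word b (w # a))
   + U (Suc k) * lin_ext (deriv word) (tri_word (x # b) (w # a))"
proof -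
  obtain j where j: "x = Suc j" using x by (cases x) auto
  let ?f = "map (refl_letter j)"
  have pos': "\<forall>x\<in>set (x # b). 1 \<le> x" using pos x by simp
  have R: "tri_word (x # b) (w # a) = word [w] * tri_rest w (x # b) a"
    by (rule tri_word_eq_rest[OF pos'])
  have rest: "tri_rest w (x # b) a = tri_word (x # b) a + blk U b j (?f (w # a)) - blk U b (Suc j) (?f a)"
    by (simp add: tri_rest_def j)
  have UA: "U (Suc k) * blk alt_diff b i u = scal ((- 1) ^ k) (alt_diff (Suc k) * blk U b i u)
      - scal ((- 1) ^ k) (blk alt_diff b (Suc k + i) u) - scal ((- 1) ^ k) (blk alt_diff b (Suc k + i) u)" for i u
    using U_mult_blk[of "Suc k" b i u] by (cases "even k") (simp_all add: falg_simps scal_2 algebra_simps)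
  \<comment> \<open>The recursion of the block sum read backwards: a sum over \<open>b\<close> with
    increased argument becomes one over \<open>x # b\<close>.\<close>
  have X1: "blk alt_diff b (Suc k + j) (?f (w # a)) = alt_diff k * tri_word (x # b) (w # a) - blk alt_diff (x # b) k (w # a)"
    and X2: "blk alt_diff b (Suc k + Suc j) (?f a) = alt_diff (Suc k) * tri_word (x # b) a - blk alt_diff (x # b) (Suc k) a"
    by (simp_all add: j)
  have "U (Suc k) * (head_weight w (tri_rest w (x # b) a) - scal (avg w) (tri_rest w (x # b) a))
      - scal ((- 1) ^ k * dif w) (alt_diff (Suc k) * tri_rest w (x # b) a) =
    scal (D w (hd a) - avg w) (U (Suc k) * tri_word (x # b) a)
    - scal ((- 1) ^ k * dif w) (alt_diff (Suc k) * tri_word (x # b) a)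
    + scal (dif w) (U (Suc k) * blk alt_diff b j (?f (w # a)) - U (Suc k) * blk alt_diff b (Suc j) (?f a))
    - scal ((- 1) ^ k * dif w) (alt_diff (Suc k) * blk U b j (?f (w # a)) - alt_diff (Suc k) * blk U b (Suc j) (?f a))
    - scal (of_bool (x = 1) * bdry w) (U (Suc k) * tri_word b (w # a))"
    unfolding j head_weight_rest(1)[OF pos] unfolding rest[unfolded j]
    by (simp add: falg_simps algebra_simps)
  also have "\<dots> = scal (D w (hd a) - avg w) (U (Suc k) * tri_word (x # b) a)
    - scal ((- 1) ^ k * dif w) (alt_diff (Suc k) * tri_word (x # b) a)
    - scal ((- 1) ^ k * dif w) (blk alt_diff b (Suc k + j) (?f (w # a)) + blk alt_diff b (Suc k + j) (?f (w # a))
        - blk alt_diff b (Suc k + Suc j) (?f a) - blk alt_diff b (Suc k + Suc j) (?f a))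
    - scal (of_bool (x = 1) * bdry w) (U (Suc k) * tri_word b (w # a))"
    unfolding UA by (simp only: falg_simps falg.scale_scale algebra_simps)
  finally have "U (Suc k) * (head_weight w (tri_rest w (x # b) a) - scal (avg w) (tri_rest w (x # b) a))
      - scal ((- 1) ^ k * dif w) (alt_diff (Suc k) * tri_rest w (x # b) a) = \<dots>" .
  \<comment> \<open>Solved for the product with U, so that it can rewrite the result of
    \<open>left_del_U\<close>.\<close>
  note Q = diff_eq_eq[THEN iffD1, OF this]
  show ?thesis
    unfolding R left_del_U lin_ext_deriv_Cons
    unfolding R[symmetric] head_weight_rest(2)[OF pos, where j = j, folded j] Q X1 X2
    by (simp only: falg_simps algebra_simps)
qed

section \<open>The three formulas of the induction\<close>

text \<open>Taking a function of \<open>b\<close> allows the same boundary term to be formed from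
  \<open>tri_word\<close> and from block sums.\<close>

definition last_term :: "(nat list \<Rightarrow> complex falg) \<Rightarrow> nat list \<Rightarrow> complex falg" where
  "last_term g b = (if b \<noteq> [] \<and> last b = 1 then g (butlast b) else 0)"

definition deriv_formula :: "nat list \<Rightarrow> complex list \<Rightarrow> bool" where
  "deriv_formula b a \<longleftrightarrow> lin_ext (deriv word) (tri_word b a) = deriv (tri_word b) a
     + (if b \<noteq> [] \<and> hd b = 1 then scal (bdry (hd a)) (tri_word (tl b) a) else 0)
     - scal (bdry (last a)) (last_term (\<lambda>b. tri_word b a) b)"

text \<open>Only the end of \<open>b\<close> contributes a boundary term here. For empty
  \<open>a\<close> the unspecified \<open>hd a\<close> does no harm, since it occurs in a
  coefficient of a block sum at the empty word, which is 0.\<close>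

definition left_del_formula :: "nat list \<Rightarrow> nat \<Rightarrow> complex \<Rightarrow> complex \<Rightarrow> complex list \<Rightarrow> bool" where
  "left_del_formula b k z w a \<longleftrightarrow> left_del z (blk U b (Suc k) (w # a)) =
     scal (avg w - avg z) (blk U b k (w # a))
   + scal (dif z + (- 1) ^ k * dif w) (blk alt_diff b k (w # a))
   + scal (D w (hd a) - avg w) (blk U b (Suc k) a)
   - scal ((- 1) ^ k * dif w) (blk alt_diff b (Suc k) a)
   + deriv (blk U b (Suc k)) (w # a)
   - scal (bdry (last (w # a))) (last_term (\<lambda>b. blk U b (Suc k) (w # a)) b)"

lemma scal_hd_refl_letter:
  "scal (D (refl_letter j w) (hd (map (refl_letter j) a)) - c) (blk f b k (map (refl_letter j) a)) =
   scal (D w (hd a) - c) (blk f b k (map (refl_letter j) a))"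
  by (cases a) simp_all

lemma left_del_formula_Nil: "left_del_formula [] k z w a"
proof -
  have "deriv (\<lambda>u. U (Suc k) * tri_word [] u) (w # a) = U (Suc k) * (word [w] * left_del w (word a))"
  proof -
    have "deriv (\<lambda>u. tri_word [] u) (w # a) = deriv word (w # a)"
      unfolding tri_word_Nil_left by (induction a arbitrary: w) (auto simp: deriv_Cons2)
    then show ?thesis by (simp add: deriv_mult deriv_word_Cons left_del_def)
  qed
  then show ?thesis
    unfolding left_del_formula_def last_term_def
    using left_del_U[of z k w "word a"]
    by (cases a) (simp_all add: blk_Nil_left tri_word_Nil_left op_defs falg_simps flip: word_append)
qed

lemma last_term_blk: "last_term (\<lambda>b. blk U b k a) (x # b) =
    U k * last_term (\<lambda>b. tri_word b a) (x # b)
    - last_term (\<lambda>b. blk U b (k + x) (map (refl_letter (x - 1)) a)) b"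
  by (simp add: last_term_def)

lemma deriv_blk: "deriv (blk U (x # b) k) a =
    U k * deriv (tri_word (x # b)) a - deriv (blk U b (k + x)) (map (refl_letter (x - 1)) a)"
  unfolding blk_Cons deriv_diff deriv_mult deriv_refl_letter[of "blk U b (k + x)"] ..

lemma neg_one_power_cancel: "(- 1) ^ (k + j) * ((- 1) ^ j * d) = (- 1) ^ k * (d :: rat)"
  "(- 1) ^ j * ((- 1) ^ j * d) = d"
  by (auto simp: minus_one_power_iff)

text \<open>The recursion calls the formula at reflected letters. Returning to the original letters
  changes no coefficient except \<open>dif\<close>, which acquires the sign of the
  reflection.\<close>

lemma left_del_formula_refl:
  assumes "left_del_formula b k z (refl_letter j w) (map (refl_letter j) a)"
  shows "left_del z (blk U b (Suc k) (map (refl_letter j) (w # a))) =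
     scal (avg w - avg z) (blk U b k (map (refl_letter j) (w # a)))
   + scal (dif z + (- 1) ^ k * ((- 1) ^ j * dif w)) (blk alt_diff b k (map (refl_letter j) (w # a)))
   + scal (D w (hd a) - avg w) (blk U b (Suc k) (map (refl_letter j) a))
   - scal ((- 1) ^ k * ((- 1) ^ j * dif w)) (blk alt_diff b (Suc k) (map (refl_letter j) a))
   + deriv (blk U b (Suc k)) (map (refl_letter j) (w # a))
   - scal (bdry (last (w # a))) (last_term (\<lambda>b. blk U b (Suc k) (map (refl_letter j) (w # a))) b)"
proof -
  have "last (refl_letter j w # map (refl_letter j) a) = refl_letter j (last (w # a))"
    using last_map[of "w # a" "refl_letter j"] by simp
  then show ?thesis
    using assms unfolding left_del_formula_def
    by (simp only: avg_refl_letter dif_refl_letter bdry_refl_letter scal_hd_refl_letter list.map)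
qed

text \<open>The head boundary term in the derivative of \<open>tri_word (x # b) (w # a)\<close>
  cancels the one that \<open>left_del_U_tri_word\<close> produces for x = 1. This is why the
  formula has none.\<close>

lemma left_del_formula_Cons:
  assumes pos: "\<forall>x\<in>set b. 1 \<le> x" and x: "x \<ge> 1"
    and main: "deriv_formula (x # b) (w # a)"
    and IH: "\<And>k z w a. left_del_formula b k z w a"
  shows "left_del_formula (x # b) k z w a"
proof -
  obtain j where j: "x = Suc j" using x by (cases x) auto
  have "(- 1) ^ (k + x) * ((- 1) ^ (x - 1) * dif w) = - ((- 1) ^ k * dif w)"
    by (auto simp: j minus_one_power_iff)
  note IH' = left_del_formula_refl[OF IH[of "k + x" z "refl_letter (x - 1) w" "map (refl_letter (x - 1)) a"],
      unfolded this add_uminus_conv_diff falg.scale_minus_left diff_minus_eq_add]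
  show ?thesis
    unfolding left_del_formula_def last_term_blk deriv_blk
    unfolding blk.simps(2)[of U] left_del_diff left_del_U_tri_word[OF pos x]
      main[unfolded deriv_formula_def] list.sel add_Suc IH'
    unfolding blk.simps(2)[of alt_diff] add_Suc
    by (cases "x = 1") (simp_all only: falg_simps algebra_simps list.sel of_bool_eq if_True if_False simp_thms
        list.distinct falg.scale_zero_left falg.scale_minus_left falg.scale_scale mult_1_left mult_zero_left
        mult_zero_right)
qed

text \<open>The case of the block argument 0, needed when the first letter of \<open>b\<close> is 1;
  then the left neighbour equals the first letter of the word. The two copies from U(0) = 2 give -2
  \<open>D z z\<close> where the pattern of the other case has -2 \<open>avg z\<close>, whence the
  last summand.\<close>

definition left_del_formula_0 :: "nat list \<Rightarrow> complex \<Rightarrow> complex list \<Rightarrow> bool" where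
  "left_del_formula_0 b z a \<longleftrightarrow> left_del z (blk U b 0 (z # a)) =
     scal (D z (hd a) - avg z) (blk U b 0 a) + scal (dif z) (blk alt_diff b 0 a)
   + deriv (blk U b 0) (z # a)
   - scal (bdry (last (z # a))) (last_term (\<lambda>b. blk U b 0 (z # a)) b)
   + scal (bdry z) (nonempty_part (tri_rest z b a))"

lemma U_0_mult: "U 0 * p = p + p"
  by (simp add: U_def word_Nil mult_2)

lemma left_del_formula_0_Nil: "left_del_formula_0 [] z a"
proof -
  have "deriv (tri_word []) (z # a) = word [z] * left_del_word z a"
    unfolding tri_word_Nil_left deriv_word_Cons[symmetric]
    by (induction a arbitrary: z) (auto simp: deriv_Cons2)
  then have "deriv (blk U [] 0) (z # a) = U 0 * (word [z] * left_del_word z a)"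
    by (simp add: blk_Nil_left deriv_mult)
  then show ?thesis
    unfolding left_del_formula_0_def
    by (cases a) (simp_all add: U_0_mult tri_word_Nil_left op_defs last_term_def tri_rest_def bdry_def
        falg_simps scal_2 flip: falg.scale_scale)
qed

lemma left_del_formula_0_Cons:
  assumes pos: "\<forall>x\<in>set b. 1 \<le> x" and x: "x \<ge> 1"
    and main: "deriv_formula (x # b) (z # a)"
    and IH: "\<And>k z w a. left_del_formula b k z w a"
  shows "left_del_formula_0 (x # b) z a"
proof -
  obtain j where j: "x = Suc j" using x by (cases x) auto
  let ?f = "map (refl_letter j)"
  have pos': "\<forall>x\<in>set (Suc j # b). 1 \<le> x" using pos by simp
  have rest: "tri_rest z (Suc j # b) a = tri_word (Suc j # b) a + blk U b j (?f (z # a)) - blk U b (Suc j) (?f a)"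
    by (simp add: tri_rest_def)
  have P: "word [z] * left_del z (tri_rest z (Suc j # b) a) = lin_ext (deriv word) (tri_word (Suc j # b) (z # a))"
    unfolding tri_word_eq_rest[OF pos'] lin_ext_deriv_Cons ..
  have R: "left_del z (tri_word (Suc j # b) (z # a)) =
     scal (D z (hd a) - avg z) (tri_word (Suc j # b) a)
     + scal (avg z - D z z) (tri_rest z (Suc j # b) a)
     + scal (dif z) (blk alt_diff b j (?f (z # a)) - blk alt_diff b (Suc j) (?f a))
      - scal (of_bool (j = 0) * bdry z) (tri_word b (z # a))
     + lin_ext (deriv word) (tri_word (Suc j # b) (z # a))"
    unfolding tri_word_eq_rest[OF pos', of z a] left_del_Cons head_weight_rest[OF pos]
    unfolding P unfolding tri_word_eq_rest[OF pos', of z a, symmetric] unfolding rest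
    by (simp only: falg_simps algebra_simps)
  note IH' = left_del_formula_refl[OF IH[of j z "refl_letter j z" "map (refl_letter j) a"],
      unfolded neg_one_power_cancel]
  show ?thesis
    unfolding left_del_formula_0_def last_term_blk deriv_blk j diff_Suc_1 add_0
    unfolding blk.simps(2)[of U] left_del_diff U_0_mult left_del_add R
      main[unfolded deriv_formula_def j] list.sel add_0 diff_Suc_1 IH' head_weight_rest(2)[OF pos]
    unfolding blk.simps(2)[of alt_diff] add_0 diff_Suc_1 alt_diff_0 bdry_def[of z]
    by (cases "j = 0") (simp_all only: falg_simps algebra_simps scal_2 of_bool_eq if_True if_False simp_thms
        list.distinct list.sel falg.scale_zero_left falg.scale_zero_right falg.scale_minus_left mult_1_left mult_zero_left
        mult_zero_right One_nat_def nat.inject add_0_left add_0_right flip: falg.scale_scale)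
qed

text \<open>In the recursion a block of argument j is followed by the letter z reflected j times.
  For j > 0 the first two coefficients of \<open>left_del_formula\<close> then vanish, so both cases
  take one shape up to the extra term at j = 0.\<close>

lemma left_del_formula_both:
  fixes z :: complex and j :: nat
  assumes "\<And>k z w a. left_del_formula b k z w a" "left_del_formula_0 b z a"
  shows "left_del z (blk U b j (map (refl_letter j) (z # a))) =
     scal (D z (hd a) - avg z) (blk U b j (map (refl_letter j) a))
   + scal (dif z) (blk alt_diff b j (map (refl_letter j) a))
   + deriv (blk U b j) (map (refl_letter j) (z # a))
   - scal (bdry (last (z # a))) (last_term (\<lambda>b. blk U b j (map (refl_letter j) (z # a))) b)
   + scal (of_bool (j = 0) * bdry z) (nonempty_part (tri_rest z b a))"
proof (cases j)
  case 0
  then show ?thesis using assms(2) by (simp add: left_del_formula_0_def)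
next
  case (Suc i)
  have *: "(- 1) ^ i * ((- 1) ^ Suc i * dif z) = - dif z"
    by (simp add: minus_one_power_iff)
  show ?thesis
    using left_del_formula_refl[OF assms(1)[of i z "refl_letter (Suc i) z" "map (refl_letter (Suc i)) a"],
        unfolded *] Suc
    by (simp del: list.map power_Suc last.simps)
qed

text \<open>If \<open>a\<close> and \<open>b\<close> are both empty, the rest is the constant 1,
  which \<open>nonempty_part\<close> kills; this is the exceptional case.\<close>

lemma nonempty_rest:
  assumes "\<forall>x\<in>set b. 1 \<le> x" "a \<noteq> [] \<or> b \<noteq> []"
  shows "word [z] * nonempty_part (tri_rest z b a) = tri_word b (z # a)"
proof (cases b)
  case Nil
  then show ?thesis
    using assms(2) by (simp add: tri_rest_def nonempty_part_def tri_word_Nil_left flip: word_append)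
next
  case (Cons x b')
  then obtain j where "x = Suc j" using assms(1) by (cases x) auto
  then show ?thesis
    using assms(1) head_weight_rest(2)[of b' z j a] tri_word_eq_rest[OF assms(1), of z a] Cons by simp
qed

lemma last_term_tri_word:
  assumes "a \<noteq> [] \<or> b \<noteq> []"
  shows "last_term (\<lambda>b. tri_word b (z # a)) (Suc j # b) = word [z] *
    (last_term (\<lambda>b. tri_word b a) (Suc j # b)
     + last_term (\<lambda>b. blk U b j (map (refl_letter j) (z # a))) b
     - last_term (\<lambda>b. blk U b (Suc j) (map (refl_letter j) a)) b)"
  using assms tri_word_Cons[of "Suc j" "butlast b" z a]
  by (simp add: last_term_def tri_word_Nil_left flip: word_append)

text \<open>Deleting \<open>w\<close> changes all three summands of the recursion. For the block sum
  that still contains \<open>z\<close>, this deletion is already part of \<open>deriv\<close> on the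
  reflected word \<open>z # w # a\<close>, with the same weight by invariance; so only the other two
  summands carry it explicitly.\<close>

lemma deriv_tri_word_Cons2:
  fixes j :: nat
  defines "f \<equiv> map (refl_letter j)"
  shows "deriv (tri_word (Suc j # b)) (z # w # a) = word [z] *
    (scal (D w (hd a) - D w z) (tri_word (Suc j # b) a - blk U b (Suc j) (f a))
     + deriv (tri_word (Suc j # b)) (w # a) + deriv (blk U b j) (f (z # w # a))
     - deriv (blk U b (Suc j)) (f (w # a)))"
proof -
  have fun_eq: "(\<lambda>u. tri_word (Suc j # b) (z # u)) =
      (\<lambda>u. word [z] * (tri_word (Suc j # b) u + blk U b j (refl_letter j z # f u) - blk U b (Suc j) (f u)))"
    by (simp add: tri_word_Cons f_def)
  have "deriv (\<lambda>u. tri_word (Suc j # b) (z # u)) (w # a) = word [z] *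
    (deriv (tri_word (Suc j # b)) (w # a) + deriv (\<lambda>u. blk U b j (refl_letter j z # u)) (f (w # a))
     - deriv (blk U b (Suc j)) (f (w # a)))"
    unfolding fun_eq deriv_mult deriv_diff deriv_add f_def
      deriv_refl_letter[of "\<lambda>u. blk U b j (refl_letter j z # u)"]
      deriv_refl_letter[of "blk U b (Suc j)"] ..
  moreover have "deriv (blk U b j) (f (z # w # a)) =
    (if a = [] then 0 else scal (D w (hd a) - D w z) (blk U b j (f (z # a))))
    + deriv (\<lambda>u. blk U b j (refl_letter j z # u)) (f (w # a))"
    by (simp add: f_def deriv_Cons2 hd_map)
  ultimately show ?thesis
    unfolding deriv_Cons2[of "tri_word (Suc j # b)"]
    by (cases "a = []") (simp_all add: f_def tri_word_Cons falg_simps)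
qed

section \<open>The simultaneous induction and the conclusion\<close>

lemma deriv_formula_Cons:
  assumes pos: "\<forall>x\<in>set b. 1 \<le> x"
    and IH: "\<And>k z w a. left_del_formula b k z w a" "\<And>z a. left_del_formula_0 b z a"
  shows "deriv_formula (Suc j # b) (z # a)"
proof (induction a arbitrary: z)
  case Nil
  have pos': "\<forall>x\<in>set (Suc j # b). 1 \<le> x" using pos by simp
  have rest: "tri_rest z (Suc j # b) [] = blk U b j (map (refl_letter j) [z])"
    by (simp add: tri_rest_def)
  have *: "lin_ext (deriv word) (tri_word (Suc j # b) [z]) =
    word [z] * (scal (of_bool (j = 0) * bdry z) (nonempty_part (tri_rest z b []))
      - scal (bdry z) (last_term (\<lambda>b. blk U b j (map (refl_letter j) [z])) b))"
    unfolding tri_word_eq_rest[OF pos'] lin_ext_deriv_Cons rest left_del_formula_both[OF IH]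
    by simp
  show ?case
  proof (cases "b = []")
    \<comment> \<open>For the single letter x_1 and a single \<open>z\<close>, the derivative is 0,
      and the head and tail boundary terms of the formula cancel each other.\<close>
    case True
    then show ?thesis
      unfolding deriv_formula_def * by (simp add: last_term_def tri_rest_def nonempty_part_def)
  next
    case False
    then show ?thesis
      unfolding deriv_formula_def * using nonempty_rest[OF pos, of "[]" z] last_term_tri_word[of "[]" b z j]
      by (simp add: falg_simps last_term_def)
  qed
next
  case (Cons w a)
  let ?f = "map (refl_letter j)"
  have pos': "\<forall>x\<in>set (Suc j # b). 1 \<le> x" using pos by simp
  have rest: "tri_rest z (Suc j # b) a = tri_word (Suc j # b) a + blk U b j (?f (z # a)) - blk U b (Suc j) (?f a)"
    for z a by (simp add: tri_rest_def)
  have P: "word [w] * left_del w (tri_rest w (Suc j # b) a) = lin_ext (deriv word) (tri_word (Suc j # b) (w # a))"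
    unfolding tri_word_eq_rest[OF pos'] lin_ext_deriv_Cons ..
  have R: "left_del z (tri_word (Suc j # b) (w # a)) =
     scal (D w (hd a) - D w z) (tri_word (Suc j # b) a)
     + scal (avg w - D w z) (blk U b j (?f (w # a)) - blk U b (Suc j) (?f a))
     + scal (dif w) (blk alt_diff b j (?f (w # a)) - blk alt_diff b (Suc j) (?f a))
      - scal (of_bool (j = 0) * bdry w) (tri_word b (w # a))
     + lin_ext (deriv word) (tri_word (Suc j # b) (w # a))"
    unfolding tri_word_eq_rest[OF pos', of w a] left_del_Cons head_weight_rest[OF pos]
    unfolding P unfolding tri_word_eq_rest[OF pos', of w a, symmetric] unfolding rest
    by (simp only: falg_simps algebra_simps)
  have main: "lin_ext (deriv word) (tri_word (Suc j # b) (w # a)) = deriv (tri_word (Suc j # b)) (w # a)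
     + scal (of_bool (j = 0) * bdry w) (tri_word b (w # a))
     - scal (bdry (last (w # a))) (last_term (\<lambda>b. tri_word b (w # a)) (Suc j # b))"
    using Cons[of w] by (simp add: deriv_formula_def)
  note key = left_del_formula_refl[OF IH(1)[of j z "refl_letter j w" "?f a"], unfolded neg_one_power_cancel]
  have "lin_ext (deriv word) (tri_word (Suc j # b) (z # w # a)) = word [z] *
     left_del z (tri_rest z (Suc j # b) (w # a))"
    unfolding tri_word_eq_rest[OF pos'] lin_ext_deriv_Cons ..
  also have "left_del z (tri_rest z (Suc j # b) (w # a)) =
    (scal (D w (hd a) - D w z) (tri_word (Suc j # b) a - blk U b (Suc j) (?f a))
     + deriv (tri_word (Suc j # b)) (w # a) + deriv (blk U b j) (?f (z # w # a))
     - deriv (blk U b (Suc j)) (?f (w # a)))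
    + scal (of_bool (j = 0) * bdry z) (nonempty_part (tri_rest z b (w # a)))
    - scal (bdry (last (w # a))) (last_term (\<lambda>b. tri_word b (w # a)) (Suc j # b)
     + last_term (\<lambda>b. blk U b j (?f (z # w # a))) b
     - last_term (\<lambda>b. blk U b (Suc j) (?f (w # a))) b)"
  proof -
    \<comment> \<open>All terms with \<open>avg\<close> or \<open>dif\<close> cancel among the three
      summands. Symmetry of \<open>D\<close> identifies the weight of \<open>z\<close> beside
      \<open>w\<close> with that of \<open>w\<close> beside \<open>z\<close>, and the boundary terms
      in \<open>bdry w\<close> from \<open>R\<close> and \<open>main\<close> cancel as well.\<close>
    have last: "last (z # w # a) = last (w # a)" by simp
    show ?thesis
      unfolding rest left_del_add left_del_diff left_del_formula_both[OF IH] R main key last list.sel D_sym[of z w]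
      by (simp only: falg_simps algebra_simps)
  qed
  finally show ?case
    using nonempty_rest[OF pos, of "w # a" z]
    unfolding deriv_formula_def deriv_tri_word_Cons2
    by (simp add: last_term_tri_word falg_simps)
qed

text \<open>The statements are proved together because they feed each other: both deletion formulas
  for \<open>b\<close> give the theorem for \<open>x # b\<close>, and this in turn gives the
  deletion formulas for \<open>x # b\<close>.\<close>

lemma deriv_tri_word:
  assumes "\<forall>x\<in>set b. 1 \<le> x"
  shows "deriv_formula b (z # a)"
proof -
  have "(\<forall>z a. deriv_formula b (z # a)) \<and> (\<forall>k z w a. left_del_formula b k z w a) \<and>
      (\<forall>z a. left_del_formula_0 b z a)"
    using assms
  proof (induction b)
    case Nil
    have "deriv (tri_word []) (z # a) = deriv word (z # a)" for z a
      unfolding tri_word_Nil_left by (induction a arbitrary: z) (auto simp: deriv_Cons2)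
    then show ?case
      by (auto simp: deriv_formula_def tri_word_Nil_left last_term_def left_del_formula_Nil left_del_formula_0_Nil)
  next
    case (Cons x b)
    then obtain j where x: "x = Suc j" by (cases x) auto
    from Cons have IH: "\<And>k z w a. left_del_formula b k z w a" "\<And>z a. left_del_formula_0 b z a"
      and pos: "\<forall>x\<in>set b. 1 \<le> x" by auto
    note main = deriv_formula_Cons[OF pos IH, of j, folded x]
    show ?case
      using main left_del_formula_Cons[OF pos _ main IH(1)] left_del_formula_0_Cons[OF pos _ main IH(1)] x
      by auto
  qed
  then show ?thesis by blast
qed

lemma deriv_eq_sum: "deriv g z = (\<Sum>i = 1..length z - 2.
    scal (D (z ! i) (z ! (i + 1)) - D (z ! i) (z ! (i - 1))) (g (take i z @ drop (i + 1) z)))"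
proof (induction g z rule: deriv.induct)
  case (1 g x y y' w)
  let ?F = "\<lambda>g z i. scal (D (z ! i) (z ! (i + 1)) - D (z ! i) (z ! (i - 1))) (g (take i z @ drop (i + 1) z))"
  have "(\<Sum>i = 1..Suc (length w). ?F g (x # y # y' # w) i) =
      ?F g (x # y # y' # w) 1 + (\<Sum>i = 1..length w. ?F g (x # y # y' # w) (Suc i))"
    by (simp add: sum.atLeast_Suc_atMost sum.atLeast_Suc_atMost_Suc_shift del: sum.cl_ivl_Suc)
  also have "(\<Sum>i = 1..length w. ?F g (x # y # y' # w) (Suc i)) =
      (\<Sum>i = 1..length w. ?F (\<lambda>u. g (x # u)) (y # y' # w) i)"
  proof (rule sum.cong)
    fix i assume "i \<in> {1..length w}"
    then show "?F g (x # y # y' # w) (Suc i) = ?F (\<lambda>u. g (x # u)) (y # y' # w) i"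
      by (cases i) simp_all
  qed simp
  finally show ?case using 1 by simp
qed simp_all

end

theorem theorem4p9:
  fixes n m :: nat and a :: "complex list" and b :: "nat list"
    and S :: "complex set" and \<alpha> \<beta> :: complex
  assumes "n \<ge> 1" and "length a = n"
    and "distinct (a @ map (\<lambda>z. 1 - z) a @ [0, 1])"
    and "S = set a \<union> (\<lambda>z. 1 - z) ` set a \<union> {0, 1}"
    and "\<alpha> \<in> S" and "\<beta> \<in> S"
    and "length b = m" and "\<forall>j\<in>set b. j \<ge> 1"
  shows "pd \<alpha> \<beta> (word b \<triangleright> word a) =
           word b \<triangleright> pd \<alpha> \<beta> (word a) +
           (if m = 0 then 0
            else scal ((Delta \<alpha> \<beta> (hd a) 0 + Delta \<alpha> \<beta> (hd a) 1 - 2 * Delta \<alpha> \<beta> (hd a) (hd a))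
                         * of_bool (hd b = 1)) (word (tl b) \<triangleright> word a)
               - scal ((Delta \<alpha> \<beta> (last a) 0 + Delta \<alpha> \<beta> (last a) 1 - 2 * Delta \<alpha> \<beta> (last a) (last a))
                         * of_bool (last b = 1)) (word (butlast b) \<triangleright> word a))"
proof -
  interpret pair_weight "Delta \<alpha> \<beta>"
    by standard (auto simp: Delta_def insert_commute)
  have pd_eq: "pd \<alpha> \<beta> = lin_ext (deriv word)"
    unfolding pd_def by (rule arg_cong[of _ _ lin_ext]) (rule ext, simp add: pd_word_def deriv_eq_sum)
  have tri_eq: "word c \<triangleright> word u = tri_word c u" for c u
    by (simp add: tri_def)
  \<comment> \<open>\<open>deriv\<close> is a linear combination of values of its function argument,
    so the linear extension of \<open>tri_word b\<close> passes through it.\<close>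
  have "word b \<triangleright> pd \<alpha> \<beta> (word a) = deriv (tri_word b) a"
    using deriv_hom[OF hom_lin_ext, of "tri_word b" word a] by (simp add: tri_def pd_eq)
  moreover obtain z a' where "a = z # a'" using assms(1,2) by (cases a) auto
  then have "deriv_formula b a" using deriv_tri_word[of b z a'] assms(8) by simp
  moreover have "bdry y = Delta \<alpha> \<beta> y 0 + Delta \<alpha> \<beta> y 1 - 2 * Delta \<alpha> \<beta> y y" for y
    by (simp add: bdry_def avg_def)
  ultimately show ?thesis
    using assms(7) unfolding deriv_formula_def last_term_def
    by (auto simp: pd_eq tri_eq)
qed

end
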